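(* $\mathcal{NGSM}\cap\mathcal{NMSO}_{\mathrm{ed}}=\mathcal{NGSM}_{\mathrm{fv}}$.
   Context: A 2gsm is $M=(Q,\Sigma_1,\Sigma_2,\delta,q_{in},q_f)$ with finite state set $Q$ and instructions $(p,\sigma,q_1,\alpha_1,\epsilon_1,q_0,\alpha_0,\epsilon_0)$, $p\neq q_f$, $\sigma\in\Sigma_1\cup\{\vdash,\dashv\}$, $\alpha_i\in\Sigma_2^*$, $\epsilon_i\in\{-1,0,+1\}$. On input $w$ the read-only tape is $\vdash w\dashv$ (positions $0..|w|+1$); start in $q_{in}$ at position 0; in state $p$ any instruction starting with $p$ may be executed: if the scanned symbol is $\sigma$, go to $q_1$, append $\alpha_1$ to the one-way output tape and move by $\epsilon_1$, else do the same with $(q_0,\alpha_0,\epsilon_0)$; the head may not leave the tape. $M$ realizes the relation of all $(w,z)$ such that some computation reaches $q_f$ having written $z$. A computation is $k$-visiting if each tape position is visited at most $k$ times; $M$ is finite visit if for some $k$ every pair in its relation has a $k$-visiting successful computation. $\mathcal{NGSM}$: transductions realized by 2gsm's; $\mathcal{NGSM}_{\mathrm{fv}}$: those realized by finite visit 2gsm's. Graphs are $(V,E,\mathrm{lab})$ with $E\subseteq V\times\Gamma\times V$, $\mathrm{lab}:V\to\Sigma$; monadic second-order logic on graphs has node and node-set variables and atomic formulas $\mathrm{lab}_\sigma(x)$, $\mathrm{edge}_\gamma(x,y)$, $x=y$, $x\in X$. A nondeterministic mso definable graph transduction is given by a domain formula $\varphi_{\mathrm{dom}}$, a finite copy set $C$,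 node formulas $\varphi^c_\sigma(x)$ and edge formulas $\varphi^{c_1,c_2}_\gamma(x,y)$, with common free node-set variables (parameters); for each input $g$ and assignment of node sets to the parameters satisfying $\varphi_{\mathrm{dom}}$, the output has nodes $(u,c)$ for which exactly one $\sigma$ satisfies $\varphi^c_\sigma(u)$ (labelled $\sigma$) and edges $((u,c_1),\gamma,(v,c_2))$ between such nodes iff $\varphi^{c_1,c_2}_\gamma(u,v)$; the transduction is the relation of all such pairs. For $w$ of length $k$, $\mathrm{ed}(w)$ has $k+1$ unlabelled nodes forming a path whose edges are labelled by the letters of $w$; $\mathcal{NMSO}_{\mathrm{ed}}$ is the family of string transductions $m$ such that $\{(\mathrm{ed}(w),\mathrm{ed}(z))\mid(w,z)\in m\}$ is a nondeterministic mso definable graph transduction. *)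

theory Defs
  imports Main
begin

datatype 'a tsym = LEnd | Sym 'a | REnd

type_synonym ('a, 'b) instr = "nat \<times> 'a tsym \<times> nat \<times> 'b list \<times> int \<times> nat \<times> 'b list \<times> int"

record ('a, 'b) gsm =
  states :: "nat set"
  delta  :: "('a, 'b) instr set"
  q_in   :: nat
  q_f    :: nat

definition gsm_wf :: "('a, 'b) gsm \<Rightarrow> bool" where
  "gsm_wf M \<longleftrightarrow> finite (states M) \<and> finite (delta M) \<and>
     q_in M \<in> states M \<and> q_f M \<in> states M \<and>
     (\<forall>(p, \<sigma>, q1, \<alpha>1, e1, q0, \<alpha>0, e0) \<in> delta M.
        p \<in> states M \<and> q1 \<in> states M \<and> q0 \<in> states M \<and> p \<noteq> q_f M \<and>
        e1 \<in> {-1, 0, 1} \<and> e0 \<in> {-1, 0, 1})"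

definition tape :: "'a list \<Rightarrow> nat \<Rightarrow> 'a tsym" where
  "tape w i = (if i = 0 then LEnd else if i \<le> length w then Sym (w ! (i - 1)) else REnd)"

text \<open>Configurations: (state, head position, output written so far).\<close>
type_synonym 'b conf = "nat \<times> nat \<times> 'b list"

definition gsm_step :: "('a, 'b) gsm \<Rightarrow> 'a list \<Rightarrow> 'b conf \<Rightarrow> 'b conf \<Rightarrow> bool" where
  "gsm_step M w c c' \<longleftrightarrow>
     (case c of (p, i, z) \<Rightarrow> case c' of (p', i', z') \<Rightarrow>
       i' \<le> length w + 1 \<and>
       (\<exists>(p0, \<sigma>, q1, \<alpha>1, e1, q0, \<alpha>0, e0) \<in> delta M. p0 = p \<and>
          (if tape w i = \<sigma>
           then p' = q1 \<and> z' = z @ \<alpha>1 \<and> int i' = int i + e1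
           else p' = q0 \<and> z' = z @ \<alpha>0 \<and> int i' = int i + e0)))"

definition gsm_comp :: "('a, 'b) gsm \<Rightarrow> 'a list \<Rightarrow> 'b conf list \<Rightarrow> bool" where
  "gsm_comp M w cs \<longleftrightarrow> cs \<noteq> [] \<and> hd cs = (q_in M, 0, []) \<and>
     (\<forall>n. Suc n < length cs \<longrightarrow> gsm_step M w (cs ! n) (cs ! Suc n))"

definition gsm_succ :: "('a, 'b) gsm \<Rightarrow> 'a list \<Rightarrow> 'b list \<Rightarrow> 'b conf list \<Rightarrow> bool" where
  "gsm_succ M w z cs \<longleftrightarrow> gsm_comp M w cs \<and> fst (last cs) = q_f M \<and> snd (snd (last cs)) = z"

definition gsm_rel :: "('a, 'b) gsm \<Rightarrow> ('a list \<times> 'b list) set" where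
  "gsm_rel M = {(w, z). \<exists>cs. gsm_succ M w z cs}"

definition k_visiting :: "nat \<Rightarrow> 'b conf list \<Rightarrow> bool" where
  "k_visiting k cs \<longleftrightarrow> (\<forall>j. card {n. n < length cs \<and> fst (snd (cs ! n)) = j} \<le> k)"

definition finite_visit :: "('a, 'b) gsm \<Rightarrow> bool" where
  "finite_visit M \<longleftrightarrow> (\<exists>k. \<forall>(w, z) \<in> gsm_rel M. \<exists>cs. gsm_succ M w z cs \<and> k_visiting k cs)"

definition NGSM :: "('a list \<times> 'b list) set set" where
  "NGSM = {m. \<exists>M :: ('a, 'b) gsm. gsm_wf M \<and> m = gsm_rel M}"

definition NGSM_fv :: "('a list \<times> 'b list) set set" where
  "NGSM_fv = {m. \<exists>M :: ('a, 'b) gsm. gsm_wf M \<and> finite_visit M \<and> m = gsm_rel M}"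

record ('n, 'l, 'e) graph =
  verts :: "'n set"
  edges :: "('n \<times> 'e \<times> 'n) set"
  lab   :: "'n \<Rightarrow> 'l"

definition graph_wf :: "('n, 'l, 'e) graph \<Rightarrow> bool" where
  "graph_wf g \<longleftrightarrow> finite (verts g) \<and> edges g \<subseteq> verts g \<times> UNIV \<times> verts g"

definition graph_iso :: "('n, 'l, 'e) graph \<Rightarrow> ('m, 'l, 'e) graph \<Rightarrow> bool" where
  "graph_iso g h \<longleftrightarrow> (\<exists>f. bij_betw f (verts g) (verts h) \<and>
     (\<forall>u \<in> verts g. lab h (f u) = lab g u) \<and>
     (\<forall>u \<in> verts g. \<forall>v \<in> verts g. \<forall>\<gamma>. (u, \<gamma>, v) \<in> edges g \<longleftrightarrow> (f u, \<gamma>, f v) \<in> edges h))"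

text \<open>MSO formulas; node variables and node-set variables are natural numbers
  (separate name spaces).\<close>
datatype ('l, 'e) mso =
    Lab 'l nat
  | Edge 'e nat nat
  | Eq nat nat
  | Mem nat nat
  | Neg "('l, 'e) mso"
  | Conj "('l, 'e) mso" "('l, 'e) mso"
  | Ex1 nat "('l, 'e) mso"
  | Ex2 nat "('l, 'e) mso"

fun fv1 :: "('l, 'e) mso \<Rightarrow> nat set" where
  "fv1 (Lab \<sigma> x) = {x}"
| "fv1 (Edge \<gamma> x y) = {x, y}"
| "fv1 (Eq x y) = {x, y}"
| "fv1 (Mem x X) = {x}"
| "fv1 (Neg \<phi>) = fv1 \<phi>"
| "fv1 (Conj \<phi> \<psi>) = fv1 \<phi> \<union> fv1 \<psi>"
| "fv1 (Ex1 x \<phi>) = fv1 \<phi> - {x}"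
| "fv1 (Ex2 X \<phi>) = fv1 \<phi>"

fun sat :: "('n, 'l, 'e) graph \<Rightarrow> (nat \<Rightarrow> 'n) \<Rightarrow> (nat \<Rightarrow> 'n set) \<Rightarrow> ('l, 'e) mso \<Rightarrow> bool" where
  "sat g \<nu> S (Lab \<sigma> x) = (lab g (\<nu> x) = \<sigma>)"
| "sat g \<nu> S (Edge \<gamma> x y) = ((\<nu> x, \<gamma>, \<nu> y) \<in> edges g)"
| "sat g \<nu> S (Eq x y) = (\<nu> x = \<nu> y)"
| "sat g \<nu> S (Mem x X) = (\<nu> x \<in> S X)"
| "sat g \<nu> S (Neg \<phi>) = (\<not> sat g \<nu> S \<phi>)"
| "sat g \<nu> S (Conj \<phi> \<psi>) = (sat g \<nu> S \<phi> \<and> sat g \<nu> S \<psi>)"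
| "sat g \<nu> S (Ex1 x \<phi>) = (\<exists>v \<in> verts g. sat g (\<nu>(x := v)) S \<phi>)"
| "sat g \<nu> S (Ex2 X \<phi>) = (\<exists>V \<subseteq> verts g. sat g \<nu> (S(X := V)) \<phi>)"

text \<open>Node formulas have free node variable 0 (= x); edge formulas have free node
  variables 0 (= x) and 1 (= y); all formulas share the free node-set variables
  (parameters).  Copy names are natural numbers.\<close>
record ('l, 'e, 'l2, 'e2) mso_trans =
  tdom   :: "('l, 'e) mso"
  copies :: "nat set"
  nodef  :: "nat \<Rightarrow> 'l2 \<Rightarrow> ('l, 'e) mso"
  edgef  :: "nat \<Rightarrow> nat \<Rightarrow> 'e2 \<Rightarrow> ('l, 'e) mso"

definition mso_trans_wf :: "('l, 'e, 'l2, 'e2) mso_trans \<Rightarrow> bool" where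
  "mso_trans_wf T \<longleftrightarrow> finite (copies T) \<and> fv1 (tdom T) = {} \<and>
     (\<forall>c \<sigma>. fv1 (nodef T c \<sigma>) \<subseteq> {0}) \<and>
     (\<forall>c1 c2 \<gamma>. fv1 (edgef T c1 c2 \<gamma>) \<subseteq> {0, 1})"

definition asg1 :: "'n \<Rightarrow> 'n \<Rightarrow> nat \<Rightarrow> 'n" where
  "asg1 u v = (\<lambda>i. if i = 0 then u else v)"

definition out_graph ::
  "('l, 'e, 'l2, 'e2) mso_trans \<Rightarrow> ('n, 'l, 'e) graph \<Rightarrow> (nat \<Rightarrow> 'n set) \<Rightarrow> ('n \<times> nat, 'l2, 'e2) graph" where
  "out_graph T g S =
    (let V = {(u, c). u \<in> verts g \<and> c \<in> copies T \<and> (\<exists>!\<sigma>. sat g (asg1 u u) S (nodef T c \<sigma>))}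
     in \<lparr> verts = V,
          edges = {((u, c1), \<gamma>, (v, c2)). (u, c1) \<in> V \<and> (v, c2) \<in> V \<and> sat g (asg1 u v) S (edgef T c1 c2 \<gamma>)},
          lab = (\<lambda>(u, c). THE \<sigma>. sat g (asg1 u u) S (nodef T c \<sigma>)) \<rparr>)"

definition mso_out :: "('l, 'e, 'l2, 'e2) mso_trans \<Rightarrow> ('n, 'l, 'e) graph \<Rightarrow> ('n \<times> nat, 'l2, 'e2) graph set" where
  "mso_out T g = {out_graph T g S | S. (\<forall>X. S X \<subseteq> verts g) \<and> sat g (\<lambda>_. undefined) S (tdom T)}"

definition ed :: "'a list \<Rightarrow> (nat, unit, 'a) graph" where
  "ed w = \<lparr> verts = {0..length w}, edges = {(i, w ! i, Suc i) | i. i < length w}, lab = (\<lambda>_. ()) \<rparr>"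

text \<open>m is in NMSO_ed iff some MSO transduction realizes exactly the graph relation
  {(ed w, ed z) | (w,z) in m}, up to isomorphism, on (finite) graphs over the
  input node/edge alphabets.\<close>
definition NMSO_ed :: "('a list \<times> 'b list) set set" where
  "NMSO_ed = {m. \<exists>T :: (unit, 'a, unit, 'b) mso_trans. mso_trans_wf T \<and>
     (\<forall>g :: (nat, unit, 'a) graph. graph_wf g \<longrightarrow>
        (\<forall>h \<in> mso_out T g. \<exists>w z. (w, z) \<in> m \<and> graph_iso g (ed w) \<and> graph_iso h (ed z)) \<and>
        (\<forall>w z. (w, z) \<in> m \<and> graph_iso g (ed w) \<longrightarrow> (\<exists>h \<in> mso_out T g. graph_iso h (ed z))))}"

end

theory Submission
  imports Defs
begin

text \<open>If \<open>gsm_rel M\<close> has only boundedly long outputs for each input, a computation that repeats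
  a pair (state, position) writes nothing in between, since otherwise the loop could be pumped; so
  the loop can be cut out, and every pair of the relation is realized by a computation without such
  repetitions. Such a computation visits each position at most once per state. As an mso definable
  transduction has linearly bounded output size, this gives one inclusion.
  For the other inclusion, finite visit again bounds the outputs, so repetition-free computations
  suffice. The parameters of the mso transduction guess which instruction is executed at each
  pair (state, position); this makes the machine deterministic, and its run is a path in a finite
  graph on copies of the nodes of \<open>ed w\<close>. Reachability in that graph is mso definable; the output
  nodes are the configurations of the run that write a letter, together with the last one.\<close>

text \<open>Both inclusions meet in one property: for each input, the outputs are bounded in length.
  Any bound depending on the input suffices for cutting out loops. Four obstacles shape the
  construction of the transduction. An mso transduction must be correct for every assignment of its
  parameters, so inconsistent guesses have to be harmless: a configuration with several guessed
  instructions has no step at all, and the domain formula demands a run that reaches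
  \<open>q_f\<close>. An instruction may write a long word or nothing, whereas an edge of
  \<open>ed z\<close> carries one letter: each instruction is split into one step per letter and a
  silent move, and silent steps are contracted afterwards. The tape has one position more than
  \<open>ed w\<close> has nodes, so a flag on the last node represents the right endmarker. Finally,
  input graphs that are not strings must be rejected, so being a string graph is itself expressed in
  mso, again through reachability.\<close>

section \<open>Paths of labelled transition relations\<close>

definition lpath :: "('d \<Rightarrow> 'l \<Rightarrow> 'd \<Rightarrow> bool) \<Rightarrow> 'd list \<Rightarrow> 'l list \<Rightarrow> bool" where
  "lpath R es ls \<longleftrightarrow> length es = Suc (length ls) \<and>
     (\<forall>i < length ls. R (es ! i) (ls ! i) (es ! Suc i))"

definition det :: "('d \<Rightarrow> 'l \<Rightarrow> 'd \<Rightarrow> bool) \<Rightarrow> bool" where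
  "det R \<longleftrightarrow> (\<forall>d l e l' e'. R d l e \<longrightarrow> R d l' e' \<longrightarrow> l = l' \<and> e = e')"

abbreviation reach :: "('d \<Rightarrow> 'l \<Rightarrow> 'd \<Rightarrow> bool) \<Rightarrow> 'd \<Rightarrow> 'd \<Rightarrow> bool" where
  "reach R \<equiv> (\<lambda>d e. \<exists>l. R d l e)\<^sup>*\<^sup>*"

lemma detD: "det R \<Longrightarrow> R d l e \<Longrightarrow> R d l' e' \<Longrightarrow> l = l' \<and> e = e'"
  unfolding det_def by blast

lemma lpath_Nil [simp]: "lpath R es [] \<longleftrightarrow> (\<exists>d. es = [d])"
  by (auto simp: lpath_def length_Suc_conv)

lemma lpath_Cons:
  "lpath R (d # es) (l # ls) \<longleftrightarrow> R d l (hd es) \<and> lpath R es ls"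
  by (cases es) (auto simp: lpath_def All_less_Suc2)

lemma lpath_not_Nil: "lpath R es ls \<Longrightarrow> es \<noteq> []"
  by (auto simp: lpath_def)

lemma lpath_ConsE:
  assumes "lpath R es (l # ls)"
  obtains d es' where "es = d # es'" "R d l (hd es')" "lpath R es' ls"
  using assms by (cases es) (auto simp: lpath_Cons lpath_def[of R "[]"])

lemma lpath_reach:
  assumes "lpath R es ls" shows "d \<in> set es \<Longrightarrow> reach R (hd es) d"
  using assms
proof (induction ls arbitrary: es)
  case Nil
  then show ?case by auto
next
  case (Cons l ls)
  from Cons.prems(2) obtain d' es' where es: "es = d' # es'" "R d' l (hd es')" "lpath R es' ls"
    by (rule lpath_ConsE)
  show ?case
  proof (cases "d = d'")
    case True
    then show ?thesis using es by auto
  next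
    case False
    then have "reach R (hd es') d" using Cons.IH es Cons.prems by auto
    then show ?thesis using es
      by (auto intro!: converse_rtranclp_into_rtranclp[of _ d'])
  qed
qed

lemma reach_lpath:
  assumes "reach R d e"
  obtains es ls where "lpath R es ls" "hd es = d" "last es = e"
proof -
  from assms have "\<exists>es ls. lpath R es ls \<and> hd es = d \<and> last es = e"
  proof (induction rule: converse_rtranclp_induct)
    case base
    have "lpath R [e] []" "hd [e] = e" "last [e] = e" by simp_all
    then show ?case by blast
  next
    case (step y z)
    then obtain es ls l where "lpath R es ls" "hd es = z" "last es = e" "R y l z" by blast
    then have "lpath R (y # es) (l # ls) \<and> hd (y # es) = y \<and> last (y # es) = e"
      using lpath_not_Nil by (auto simp: lpath_Cons)
    then show ?case by blast
  qed
  then show thesis using that by blast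
qed

lemma lpath_append:
  assumes "lpath R es ls" "lpath R fs ms" "last es = hd fs"
  shows "lpath R (es @ tl fs) (ls @ ms)"
  using assms
proof (induction ls arbitrary: es)
  case Nil
  then show ?case using lpath_not_Nil[OF Nil(2)] by auto
next
  case (Cons l ls)
  from Cons.prems(1) obtain d es' where es: "es = d # es'" "R d l (hd es')" "lpath R es' ls"
    by (rule lpath_ConsE)
  then show ?case using Cons lpath_not_Nil[OF es(3)]
    by (auto simp: lpath_Cons)
qed

lemma lpath_take:
  assumes "lpath R es ls" "i < length es"
  shows "lpath R (take (Suc i) es) (take i ls)"
  using assms by (auto simp: lpath_def)

lemma lpath_drop:
  assumes "lpath R es ls" "i < length es"
  shows "lpath R (drop i es) (drop i ls)"
  using assms by (auto simp: lpath_def)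

text \<open>By determinism a repetition propagates forward: equal entries have equal successors.
  Once the later copy has arrived at the end of the path, some earlier entry equals the dead end
  although it still has a successor.\<close>

lemma lpath_distinct:
  assumes det: "det R" and path: "lpath R es ls" and fin: "\<And>l e. \<not> R (last es) l e"
  shows "distinct es"
proof -
  have len: "length es = Suc (length ls)" using path by (auto simp: lpath_def)
  have step: "R (es ! i) (ls ! i) (es ! Suc i)" if "i < length ls" for i
    using path that by (auto simp: lpath_def)
  have False if "i < j" "j < length es" "es ! i = es ! j" for i j
  proof -
    have "es ! (i + k) = es ! (j + k)" if "j + k < length es" for k
      using that
    proof (induction k)
      case 0
      then show ?case using \<open>es ! i = es ! j\<close> by simp
    next
      case (Suc k)
      then show ?case
        using step[of "i + k"] step[of "j + k"] detD[OF det] \<open>i < j\<close> len by fastforce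
    qed
    from this[of "length ls - j"] have "es ! (i + (length ls - j)) = es ! length ls"
      using that len by simp
    moreover have "last es = es ! length ls"
      using len by (metis diff_Suc_1 last_conv_nth length_0_conv nat.distinct(1))
    ultimately show False
      using step[of "i + (length ls - j)"] fin that len by (metis add.commute add_diff_inverse_nat add_less_mono1 less_Suc_eq_le not_less)
  qed
  then show ?thesis
    by (metis distinct_conv_nth nat_neq_iff)
qed

lemma lpath_step_iff:
  assumes "det R" "lpath R es ls" "\<And>l e. \<not> R (last es) l e" "i < length es"
  shows "R (es ! i) l e \<longleftrightarrow> i < length ls \<and> l = ls ! i \<and> e = es ! Suc i"
proof (cases "i < length ls")
  case True
  then have "R (es ! i) (ls ! i) (es ! Suc i)" using assms by (auto simp: lpath_def)
  then show ?thesis using True detD[OF assms(1)] by blast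
next
  case False
  then have "es ! i = last es"
    using assms(2,4) last_conv_nth[OF lpath_not_Nil[OF assms(2)]]
    by (auto simp: lpath_def less_Suc_eq)
  then show ?thesis using assms(3) False by auto
qed

lemma reach_in_lpath:
  assumes "det R" "lpath R es ls" "\<And>l e. \<not> R (last es) l e" "reach R (hd es) d"
  shows "d \<in> set es"
  using assms(4)
proof (induction rule: rtranclp_induct)
  case base
  then show ?case using lpath_not_Nil[OF assms(2)] by simp
next
  case (step y z)
  then obtain i l where "i < length es" "es ! i = y" "R y l z" by (auto simp: in_set_conv_nth)
  then show ?case using lpath_step_iff[OF assms(1-3), of i l z] assms(2) by (auto simp: lpath_def)
qed

text \<open>A complete deterministic path has no repetitions, and its only transitions lead from one
  entry to the next, so numbering the entries is the isomorphism. The lemma serves twice: with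
  \<open>k = fst\<close> it recognizes input strings, with the encoding of copies it identifies the
  output graph.\<close>

lemma lpath_graph_iso:
  fixes h :: "('m, unit, 'e) graph"
  assumes R: "det R" "lpath R es z" "\<And>l e. \<not> R (last es) l e"
    and k: "inj_on k (set es)" and verts: "verts h = k ` set es"
    and edges: "\<And>u v \<gamma>. u \<in> set es \<Longrightarrow> v \<in> set es \<Longrightarrow> (k u, \<gamma>, k v) \<in> edges h \<longleftrightarrow> R u \<gamma> v"
  shows "graph_iso h (ed z)"
proof -
  have len: "length es = Suc (length z)" using R(2) by (auto simp: lpath_def)
  have dist: "distinct es" by (rule lpath_distinct[OF R])
  let ?n = "\<lambda>i. k (es ! i)"
  have bij: "bij_betw ?n {0..length z} (verts h)"
    using bij_betw_trans[OF bij_betw_nth[OF dist, of "{0..length z}"] inj_on_imp_bij_betw[OF k]]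
    unfolding verts o_def by (simp add: len lessThan_Suc_atMost atMost_atLeast0)
  define f where "f = inv_into {0..length z} ?n"
  have f: "bij_betw f (verts h) {0..length z}"
    unfolding f_def by (rule bij_betw_inv_into[OF bij])
  have f_n: "f (?n i) = i" if "i \<le> length z" for i
    unfolding f_def using bij_betw_inv_into_left[OF bij] that by simp
  have edge: "(u, \<gamma>, v) \<in> edges h \<longleftrightarrow> (f u, \<gamma>, f v) \<in> edges (ed z)"
    if "u \<in> verts h" "v \<in> verts h" for u v \<gamma>
  proof -
    have "\<exists>i j. u = ?n i \<and> v = ?n j \<and> i \<le> length z \<and> j \<le> length z"
      using that unfolding bij_betw_imp_surj_on[OF bij, symmetric] by fastforce
    then obtain i j where ij: "u = ?n i" "v = ?n j" "i \<le> length z" "j \<le> length z"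
      by blast
    have "(u, \<gamma>, v) \<in> edges h \<longleftrightarrow> R (es ! i) \<gamma> (es ! j)"
      using ij len by (simp add: edges)
    also have "\<dots> \<longleftrightarrow> i < length z \<and> \<gamma> = z ! i \<and> es ! j = es ! Suc i"
      using lpath_step_iff[OF R, of i] ij len by auto
    also have "\<dots> \<longleftrightarrow> i < length z \<and> \<gamma> = z ! i \<and> j = Suc i"
      using dist ij len by (auto simp: nth_eq_iff_index_eq)
    finally show ?thesis using ij f_n by (auto simp: ed_def)
  qed
  show ?thesis
    unfolding graph_iso_def
    using f edge by (intro exI[of _ f]) (auto simp: ed_def)
qed

section \<open>Definable reachability\<close>

text \<open>The syntax has no constant for truth; binding the variable keeps the formula closed, so
  using it never adds free variables.\<close>

definition TT :: "('l, 'e) mso" where "TT = Neg (Ex1 0 (Neg (Eq 0 0)))"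
definition Disj :: "('l, 'e) mso \<Rightarrow> ('l, 'e) mso \<Rightarrow> ('l, 'e) mso" where
  "Disj \<phi> \<psi> = Neg (Conj (Neg \<phi>) (Neg \<psi>))"
definition All1 :: "nat \<Rightarrow> ('l, 'e) mso \<Rightarrow> ('l, 'e) mso" where
  "All1 x \<phi> = Neg (Ex1 x (Neg \<phi>))"
text \<open>For a finite index set an arbitrary enumeration is chosen; neither truth value nor free
  variables depend on it.\<close>

definition Conjs :: "'i set \<Rightarrow> ('i \<Rightarrow> ('l, 'e) mso) \<Rightarrow> ('l, 'e) mso" where
  "Conjs A \<phi> = foldr (\<lambda>i. Conj (\<phi> i)) (SOME xs. set xs = A) TT"
definition Disjs :: "'i set \<Rightarrow> ('i \<Rightarrow> ('l, 'e) mso) \<Rightarrow> ('l, 'e) mso" where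
  "Disjs A \<phi> = Neg (Conjs A (\<lambda>i. Neg (\<phi> i)))"
definition Ex2s :: "nat list \<Rightarrow> ('l, 'e) mso \<Rightarrow> ('l, 'e) mso" where
  "Ex2s Xs \<phi> = foldr Ex2 Xs \<phi>"

lemma sat_TT [simp]: "sat g \<nu> S TT" by (simp add: TT_def)
lemma sat_Disj [simp]: "sat g \<nu> S (Disj \<phi> \<psi>) \<longleftrightarrow> sat g \<nu> S \<phi> \<or> sat g \<nu> S \<psi>"
  by (simp add: Disj_def)
lemma sat_All1 [simp]: "sat g \<nu> S (All1 x \<phi>) \<longleftrightarrow> (\<forall>v \<in> verts g. sat g (\<nu>(x := v)) S \<phi>)"
  by (simp add: All1_def)
lemma fv1_TT [simp]: "fv1 TT = {}" by (simp add: TT_def)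
lemma fv1_Disj [simp]: "fv1 (Disj \<phi> \<psi>) = fv1 \<phi> \<union> fv1 \<psi>" by (simp add: Disj_def)
lemma fv1_All1 [simp]: "fv1 (All1 x \<phi>) = fv1 \<phi> - {x}" by (simp add: All1_def)

lemma sat_Conjs [simp]:
  assumes "finite A" shows "sat g \<nu> S (Conjs A \<phi>) \<longleftrightarrow> (\<forall>i\<in>A. sat g \<nu> S (\<phi> i))"
proof -
  have "sat g \<nu> S (foldr (\<lambda>i. Conj (\<phi> i)) xs TT) \<longleftrightarrow> (\<forall>i\<in>set xs. sat g \<nu> S (\<phi> i))" for xs
    by (induction xs) auto
  then show ?thesis
    unfolding Conjs_def using someI_ex[OF finite_list[OF assms]] by simp
qed

lemma fv1_Conjs [simp]:
  assumes "finite A" shows "fv1 (Conjs A \<phi>) = (\<Union>i\<in>A. fv1 (\<phi> i))"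
proof -
  have "fv1 (foldr (\<lambda>i. Conj (\<phi> i)) xs TT) = (\<Union>i\<in>set xs. fv1 (\<phi> i))" for xs
    by (induction xs) auto
  then show ?thesis
    unfolding Conjs_def using someI_ex[OF finite_list[OF assms]] by simp
qed

lemma sat_Disjs [simp]:
  "finite A \<Longrightarrow> sat g \<nu> S (Disjs A \<phi>) \<longleftrightarrow> (\<exists>i\<in>A. sat g \<nu> S (\<phi> i))"
  by (simp add: Disjs_def)

lemma fv1_Disjs [simp]: "finite A \<Longrightarrow> fv1 (Disjs A \<phi>) = (\<Union>i\<in>A. fv1 (\<phi> i))"
  by (simp add: Disjs_def)

text \<open>Turns the nested updates of a quantifier block into one joint assignment, so that a
  whole family of sets can be supplied as a single witness.\<close>

lemma sat_Ex2s:
  "sat g \<nu> S (Ex2s Xs \<phi>) \<longleftrightarrow>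
    (\<exists>S'. (\<forall>X \<in> set Xs. S' X \<subseteq> verts g) \<and> (\<forall>X. X \<notin> set Xs \<longrightarrow> S' X = S X) \<and> sat g \<nu> S' \<phi>)"
proof (induction Xs arbitrary: S)
  case Nil
  have "(\<forall>X. S' X = S X) \<longleftrightarrow> S' = S" for S' :: "nat \<Rightarrow> 'a set" by auto
  then show ?case by (simp add: Ex2s_def)
next
  case (Cons X Xs)
  have "sat g \<nu> S (Ex2s (X # Xs) \<phi>) \<longleftrightarrow> (\<exists>V\<subseteq>verts g. sat g \<nu> (S(X := V)) (Ex2s Xs \<phi>))"
    by (simp add: Ex2s_def)
  also have "\<dots> \<longleftrightarrow> (\<exists>V\<subseteq>verts g. \<exists>S'. (\<forall>Y \<in> set Xs. S' Y \<subseteq> verts g) \<and>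
     (\<forall>Y. Y \<notin> set Xs \<longrightarrow> S' Y = (S(X := V)) Y) \<and> sat g \<nu> S' \<phi>)"
    by (simp only: Cons.IH)
  also have "\<dots> \<longleftrightarrow> (\<exists>S'. (\<forall>Y \<in> set (X # Xs). S' Y \<subseteq> verts g) \<and>
     (\<forall>Y. Y \<notin> set (X # Xs) \<longrightarrow> S' Y = S Y) \<and> sat g \<nu> S' \<phi>)" (is "?l \<longleftrightarrow> ?r")
  proof
    assume ?l
    then obtain V S' where "V \<subseteq> verts g" "\<forall>Y \<in> set Xs. S' Y \<subseteq> verts g"
      "\<forall>Y. Y \<notin> set Xs \<longrightarrow> S' Y = (S(X := V)) Y" "sat g \<nu> S' \<phi>" by blast
    then show ?r by (intro exI[of _ S']) (cases "X \<in> set Xs"; auto)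
  next
    assume ?r
    then obtain S' where S': "\<forall>Y \<in> set (X # Xs). S' Y \<subseteq> verts g"
      "\<forall>Y. Y \<notin> set (X # Xs) \<longrightarrow> S' Y = S Y" "sat g \<nu> S' \<phi>" by blast
    have "\<forall>Y \<in> set Xs. S' Y \<subseteq> verts g" "S' X \<subseteq> verts g" using S'(1) by simp_all
    moreover have "\<forall>Y. Y \<notin> set Xs \<longrightarrow> S' Y = (S(X := S' X)) Y" using S'(2) by simp
    ultimately show ?l
      by (intro exI[of _ "S' X"] conjI exI[of _ S'] S'(3))
  qed
  finally show ?case .
qed

lemma fv1_Ex2s [simp]: "fv1 (Ex2s Xs \<phi>) = fv1 \<phi>"
  by (induction Xs) (auto simp: Ex2s_def)

text \<open>Copy names and set variables are natural numbers, while the natural indices here are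
  tuples; any injection will do.\<close>

definition enc :: "'c set \<Rightarrow> 'c \<Rightarrow> nat" where
  "enc C = (SOME f. inj_on f C)"

lemma inj_on_enc: "finite C \<Longrightarrow> inj_on (enc C) C"
  using someI_ex[of "\<lambda>f :: 'a \<Rightarrow> nat. inj_on f C"] finite_imp_inj_to_nat_seg[of C]
  by (auto simp: enc_def)

text \<open>Even set variables hold the parameters of a transduction; the odd ones are reserved for
  the quantifiers of \<open>reach_fm\<close>, one for each copy in \<open>C\<close>.\<close>

locale definable =
  fixes C :: "'c set" and L :: "'l set"
    and E :: "'c \<Rightarrow> 'l \<Rightarrow> 'c \<Rightarrow> nat \<Rightarrow> nat \<Rightarrow> ('v, 'e) mso"
    and P :: "('n, 'v, 'e) graph \<Rightarrow> (nat \<Rightarrow> 'n set) \<Rightarrow> 'n \<times> 'c \<Rightarrow> 'l \<Rightarrow> 'n \<times> 'c \<Rightarrow> bool"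
  assumes finite_C: "finite C" and finite_L: "finite L"
    and sat_E: "\<And>g \<nu> S c l c' x y. sat g \<nu> S (E c l c' x y) \<longleftrightarrow>
      P g (\<lambda>n. S (2 * n)) (\<nu> x, c) l (\<nu> y, c')"
    and fv1_E: "\<And>c l c' x y. fv1 (E c l c' x y) \<subseteq> {x, y}"
begin

text \<open>The quantifiers of a formula only see vertices and the listed copies, so
  \<open>P\<close> is cut down to these. Restricting the labels by \<open>L\<close> lets the same
  \<open>P\<close> yield both the full relation and its silent part.\<close>

definition rel :: "('n, 'v, 'e) graph \<Rightarrow> (nat \<Rightarrow> 'n set) \<Rightarrow> 'n \<times> 'c \<Rightarrow> 'l \<Rightarrow> 'n \<times> 'c \<Rightarrow> bool" where
  "rel g S d l e \<longleftrightarrow> d \<in> verts g \<times> C \<and> l \<in> L \<and> e \<in> verts g \<times> C \<and> P g S d l e"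

definition setvar :: "'c \<Rightarrow> nat" where "setvar c = Suc (2 * enc C c)"

definition closed_fm :: "('v, 'e) mso" where
  "closed_fm = Conjs (C \<times> L \<times> C) (\<lambda>(c, l, c'). Neg (Ex1 0 (Ex1 1
     (Conj (Mem 0 (setvar c)) (Conj (E c l c' 0 1) (Neg (Mem 1 (setvar c'))))))))"

text \<open>The usual second-order definition of transitive closure: every closed family containing
  the source contains the target. Since steps lead from copy to copy, the family has one set per
  copy instead of a single set.\<close>

definition reach_fm :: "'c \<Rightarrow> 'c \<Rightarrow> nat \<Rightarrow> nat \<Rightarrow> ('v, 'e) mso" where
  "reach_fm c c' x y = Neg (Ex2s (SOME Xs. set Xs = setvar ` C)
     (Conj closed_fm (Conj (Mem x (setvar c)) (Neg (Mem y (setvar c'))))))"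

lemma setvar_eq_iff: "c \<in> C \<Longrightarrow> c' \<in> C \<Longrightarrow> setvar c = setvar c' \<longleftrightarrow> c = c'"
  using inj_on_enc[OF finite_C] by (auto simp: setvar_def inj_on_def)

lemma setvar_odd: "setvar c \<noteq> 2 * n"
  unfolding setvar_def by presburger

lemma fv1_closed_fm: "fv1 closed_fm = {}"
proof -
  have "fv1 (E c l c' 0 1) - {1} - {0} = {}" for c l c' using fv1_E[of c l c' 0 1] by blast
  then show ?thesis by (auto simp: closed_fm_def finite_C finite_L)
qed

lemma fv1_reach_fm: "fv1 (reach_fm c c' x y) = {x, y}"
  by (auto simp: reach_fm_def fv1_closed_fm)

lemma sat_closed_fm:
  "sat g \<nu> S closed_fm \<longleftrightarrow>
    (\<forall>u c l v c'. u \<in> S (setvar c) \<longrightarrow> rel g (\<lambda>n. S (2 * n)) (u, c) l (v, c') \<longrightarrow> v \<in> S (setvar c'))"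
proof -
  have "sat g \<nu> S closed_fm \<longleftrightarrow> (\<forall>c\<in>C. \<forall>l\<in>L. \<forall>c'\<in>C. \<forall>u\<in>verts g. u \<in> S (setvar c) \<longrightarrow>
    (\<forall>v\<in>verts g. P g (\<lambda>n. S (2 * n)) (u, c) l (v, c') \<longrightarrow> v \<in> S (setvar c')))"
    by (simp add: closed_fm_def finite_C finite_L sat_E ball_simps)
  then show ?thesis unfolding rel_def by blast
qed

lemma sat_reach_fm:
  assumes "\<nu> x \<in> verts g" "c \<in> C" "c' \<in> C"
  shows "sat g \<nu> S (reach_fm c c' x y) \<longleftrightarrow> reach (rel g (\<lambda>n. S (2 * n))) (\<nu> x, c) (\<nu> y, c')"
    (is "_ \<longleftrightarrow> reach ?R _ _")
proof -
  let ?Xs = "SOME Xs. set Xs = setvar ` C"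
  have Xs: "set ?Xs = setvar ` C"
    using someI_ex[OF finite_list, of "setvar ` C"] finite_C by simp
  show ?thesis
  proof
    assume sat: "sat g \<nu> S (reach_fm c c' x y)"
    \<comment> \<open>The witness is the least closed family: copy by copy, the vertices that are
      actually reachable.\<close>
    define D where "D b = {v \<in> verts g. reach ?R (\<nu> x, c) (v, b)}" for b
    define S' where "S' X = (if X \<in> setvar ` C then D (SOME b. b \<in> C \<and> X = setvar b) else S X)" for X
    have S'_var: "S' (setvar b) = D b" if "b \<in> C" for b
    proof -
      have "(SOME a. a \<in> C \<and> setvar b = setvar a) = b"
        using that by (intro some_equality) (auto simp: setvar_eq_iff)
      then show ?thesis using that by (simp add: S'_def)
    qed
    \<comment> \<open>The quantified variables are odd, so the parameters, and with them the
      relation, remain the same.\<close>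
    have S'_even: "(\<lambda>n. S' (2 * n)) = (\<lambda>n. S (2 * n))"
    proof
      fix n have "2 * n \<notin> setvar ` C" using setvar_odd by (metis imageE)
      then show "S' (2 * n) = S (2 * n)" by (simp add: S'_def)
    qed
    have "sat g \<nu> S' closed_fm"
      unfolding sat_closed_fm S'_even
    proof (intro allI impI)
      fix u b l v b' assume u: "u \<in> S' (setvar b)" and r: "?R (u, b) l (v, b')"
      then have "b \<in> C" "b' \<in> C" "v \<in> verts g" by (auto simp: rel_def)
      with u r show "v \<in> S' (setvar b')"
        by (auto simp: S'_var D_def intro: rtranclp.rtrancl_into_rtrancl)
    qed
    moreover have "\<nu> x \<in> S' (setvar c)" using assms by (simp add: S'_var D_def)
    moreover have "\<forall>X\<in>setvar ` C. S' X \<subseteq> verts g" using S'_var by (auto simp: D_def)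
    moreover have "\<forall>X. X \<notin> setvar ` C \<longrightarrow> S' X = S X" by (simp add: S'_def)
    ultimately have "\<nu> y \<in> S' (setvar c')"
      using sat unfolding reach_fm_def sat.simps sat_Ex2s Xs by blast
    then show "reach ?R (\<nu> x, c) (\<nu> y, c')" using assms by (simp add: S'_var D_def)
  next
    assume r: "reach ?R (\<nu> x, c) (\<nu> y, c')"
    have "\<nu> y \<in> S' (setvar c')"
      if S': "\<forall>X. X \<notin> setvar ` C \<longrightarrow> S' X = S X" "sat g \<nu> S' closed_fm" "\<nu> x \<in> S' (setvar c)" for S'
    proof -
      have even: "(\<lambda>n. S' (2 * n)) = (\<lambda>n. S (2 * n))"
        using S'(1) setvar_odd by (metis imageE)
      have "fst e \<in> S' (setvar (snd e))" if "reach ?R (\<nu> x, c) e" for e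
        using that
      proof (induction rule: rtranclp_induct)
        case base
        then show ?case using S' by simp
      next
        case (step d e)
        then show ?case using S'(2) unfolding sat_closed_fm even
          by (metis prod.collapse)
      qed
      from this[OF r] show ?thesis by simp
    qed
    then show "sat g \<nu> S (reach_fm c c' x y)"
      unfolding reach_fm_def sat.simps sat_Ex2s Xs by blast
  qed
qed

end

section \<open>String graphs\<close>

text \<open>Keeps the isomorphism \<open>f\<close> in view, because tape positions are computed from
  the position \<open>f u\<close> of a node.\<close>

definition ed_iso :: "('n, unit, 'a) graph \<Rightarrow> 'a list \<Rightarrow> ('n \<Rightarrow> nat) \<Rightarrow> bool" where
  "ed_iso g w f \<longleftrightarrow> bij_betw f (verts g) {0..length w} \<and>
     (\<forall>u \<in> verts g. \<forall>v \<in> verts g. \<forall>\<gamma>.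
       (u, \<gamma>, v) \<in> edges g \<longleftrightarrow> f u < length w \<and> \<gamma> = w ! f u \<and> f v = Suc (f u))"

lemma graph_iso_ed_iff: "graph_iso g (ed w) \<longleftrightarrow> (\<exists>f. ed_iso g w f)"
  by (auto simp: graph_iso_def ed_iso_def ed_def)

definition first :: "('n, 'v, 'e) graph \<Rightarrow> 'n \<Rightarrow> bool" where
  "first g u \<longleftrightarrow> \<not> (\<exists>v \<in> verts g. \<exists>\<gamma>. (v, \<gamma>, u) \<in> edges g)"
definition final :: "('n, 'v, 'e) graph \<Rightarrow> 'n \<Rightarrow> bool" where
  "final g u \<longleftrightarrow> \<not> (\<exists>v \<in> verts g. \<exists>\<gamma>. (u, \<gamma>, v) \<in> edges g)"

text \<open>The bound variable \<open>Suc x\<close> cannot capture \<open>x\<close>, and the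
  disjunction over all edge labels is a formula because the alphabet is finite.\<close>

definition first_fm :: "nat \<Rightarrow> ('v, 'e::finite) mso" where
  "first_fm x = Neg (Ex1 (Suc x) (Disjs UNIV (\<lambda>\<gamma>. Edge \<gamma> (Suc x) x)))"
definition final_fm :: "nat \<Rightarrow> ('v, 'e::finite) mso" where
  "final_fm x = Neg (Ex1 (Suc x) (Disjs UNIV (\<lambda>\<gamma>. Edge \<gamma> x (Suc x))))"

lemma sat_first_fm [simp]: "sat g \<nu> S (first_fm x) \<longleftrightarrow> first g (\<nu> x)"
  by (simp add: first_fm_def first_def)
lemma sat_final_fm [simp]: "sat g \<nu> S (final_fm x) \<longleftrightarrow> final g (\<nu> x)"
  by (simp add: final_fm_def final_def)
lemma fv1_first_fm [simp]: "fv1 (first_fm x) = {x}"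
  by (auto simp: first_fm_def)
lemma fv1_final_fm [simp]: "fv1 (final_fm x) = {x}"
  by (auto simp: final_fm_def)

lemma ed_iso_vertex:
  assumes "ed_iso g w f" "i \<le> length w" obtains u where "u \<in> verts g" "f u = i"
proof -
  have "i \<in> f ` verts g" using assms by (auto simp: ed_iso_def bij_betw_def)
  then show thesis using that by blast
qed

lemma ed_iso_eq_iff:
  "ed_iso g w f \<Longrightarrow> u \<in> verts g \<Longrightarrow> v \<in> verts g \<Longrightarrow> f u = f v \<longleftrightarrow> u = v"
  by (auto simp: ed_iso_def bij_betw_def inj_on_def)

lemma ed_iso_le: "ed_iso g w f \<Longrightarrow> u \<in> verts g \<Longrightarrow> f u \<le> length w"
  by (auto simp: ed_iso_def bij_betw_def)

lemma ed_iso_edge: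
  "ed_iso g w f \<Longrightarrow> u \<in> verts g \<Longrightarrow> v \<in> verts g \<Longrightarrow>
   (u, \<gamma>, v) \<in> edges g \<longleftrightarrow> f u < length w \<and> \<gamma> = w ! f u \<and> f v = Suc (f u)"
  by (auto simp: ed_iso_def)

lemma ed_iso_first:
  assumes f: "ed_iso g w f" and u: "u \<in> verts g"
  shows "first g u \<longleftrightarrow> f u = 0"
proof (cases "f u")
  case 0
  then show ?thesis using f u by (auto simp: first_def ed_iso_edge)
next
  case (Suc i)
  then have "i \<le> length w" using ed_iso_le[OF f u] by simp
  then obtain v where "v \<in> verts g" "f v = i" by (rule ed_iso_vertex[OF f])
  then have "(v, w ! i, u) \<in> edges g" using Suc ed_iso_le[OF f u] f u by (simp add: ed_iso_edge)
  then show ?thesis using Suc \<open>v \<in> verts g\<close> by (auto simp: first_def)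
qed

lemma ed_iso_final:
  assumes f: "ed_iso g w f" and u: "u \<in> verts g"
  shows "final g u \<longleftrightarrow> f u = length w"
proof (cases "f u = length w")
  case True
  then show ?thesis using f u by (auto simp: final_def ed_iso_edge)
next
  case False
  then have le: "Suc (f u) \<le> length w" using ed_iso_le[OF f u] by simp
  then obtain v where "v \<in> verts g" "f v = Suc (f u)" by (rule ed_iso_vertex[OF f])
  then show ?thesis using le f u by (auto simp: final_def ed_iso_edge)
qed

text \<open>With one dummy copy, reachability in the input graph itself becomes an instance of
  \<open>definable\<close>.\<close>

definition edge_rel :: "('n, 'v, 'e) graph \<Rightarrow> 'n \<times> unit \<Rightarrow> 'e \<Rightarrow> 'n \<times> unit \<Rightarrow> bool" where
  "edge_rel g d \<gamma> e \<longleftrightarrow> (fst d, \<gamma>, fst e) \<in> edges g"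

interpretation str: definable "{()}" "UNIV :: 'e::finite set"
    "\<lambda>_ \<gamma> _ x y. Edge \<gamma> x y" "\<lambda>g S. edge_rel g"
  by unfold_locales (auto simp: edge_rel_def)

lemma str_rel_iff:
  "str.rel g S d \<gamma> e \<longleftrightarrow> fst d \<in> verts g \<and> fst e \<in> verts g \<and> (fst d, \<gamma>, fst e) \<in> edges g"
  unfolding str.rel_def unfolding edge_rel_def by (auto simp: mem_Times_iff)

definition det_fm :: "('v, 'e::finite) mso" where
  "det_fm = All1 0 (All1 1 (All1 2 (Conjs UNIV (\<lambda>\<gamma>. Conjs UNIV (\<lambda>\<gamma>'.
     Neg (Conj (Conj (Edge \<gamma> 0 1) (Edge \<gamma>' 0 2)) (if \<gamma> = \<gamma>' then Neg (Eq 1 2) else TT)))))))"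

text \<open>A deterministic graph all of whose nodes are reachable from one root is a path, possibly
  running back into itself; a node without outgoing edges excludes the loop.\<close>

definition string_fm :: "(unit, 'e::finite) mso" where
  "string_fm = Conj det_fm (Ex1 0 (Conj (All1 1 (str.reach_fm () () 0 1)) (Ex1 1 (final_fm 1))))"

lemma fv1_string_fm: "fv1 string_fm = {}"
proof -
  have "fv1 det_fm = {}"
    by (simp add: det_fm_def if_distrib[of fv1] cong: if_cong) auto
  then show ?thesis by (auto simp: string_fm_def str.fv1_reach_fm)
qed

lemma sat_det_fm:
  "sat g \<nu> S det_fm \<longleftrightarrow> (\<forall>u\<in>verts g. \<forall>v\<in>verts g. \<forall>v'\<in>verts g. \<forall>\<gamma> \<gamma>'.
     (u, \<gamma>, v) \<in> edges g \<longrightarrow> (u, \<gamma>', v') \<in> edges g \<longrightarrow> \<gamma> = \<gamma>' \<and> v = v')"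
proof -
  have "sat g \<nu> S (if b then Neg (Eq 1 2) else TT) \<longleftrightarrow> \<not> (b \<and> \<nu> 1 = \<nu> 2)" for \<nu> b
    by simp
  then show ?thesis unfolding det_fm_def by simp meson
qed

text \<open>The path from the root to the dead end contains, by determinism, everything reachable
  from the root, hence all vertices. \<open>lpath_graph_iso\<close> then reads off the word.\<close>

lemma sat_string_fm:
  fixes g :: "('n, unit, 'e::finite) graph"
  shows "sat g \<nu> S string_fm \<longleftrightarrow> (\<exists>w. graph_iso g (ed w))"
proof
  let ?R = "str.rel g (\<lambda>n. S (2 * n)) :: 'n \<times> unit \<Rightarrow> 'e \<Rightarrow> 'n \<times> unit \<Rightarrow> bool"
  assume sat: "sat g \<nu> S string_fm"
  then have "sat g \<nu> S det_fm" by (simp add: string_fm_def)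
  then have uniq: "\<gamma> = \<gamma>' \<and> v = v'" if "u \<in> verts g" "v \<in> verts g" "v' \<in> verts g"
      "(u, \<gamma>, v) \<in> edges g" "(u, \<gamma>', v') \<in> edges g" for u v v' \<gamma> \<gamma>'
    using that unfolding sat_det_fm by meson
  have det: "det ?R"
    unfolding det_def str_rel_iff by (auto dest: uniq)
  from sat obtain u v where uv: "u \<in> verts g" "v \<in> verts g" "final g v"
    and reach: "\<And>x. x \<in> verts g \<Longrightarrow> reach ?R (u, ()) (x, ())"
    by (auto simp: string_fm_def str.sat_reach_fm)
  from reach[OF uv(2)] obtain es w where es: "lpath ?R es w" "hd es = (u, ())" "last es = (v, ())"
    by (rule reach_lpath)
  have fin: "\<not> ?R (last es) l e" for l e
    using uv(3) by (auto simp: es final_def str_rel_iff)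
  have "d \<in> set es \<longleftrightarrow> fst d \<in> verts g" for d
  proof
    assume "d \<in> set es"
    then have "reach ?R (u, ()) d" using lpath_reach[OF es(1)] es(2) by simp
    then show "fst d \<in> verts g"
      by (cases rule: rtranclp.cases) (use uv in \<open>auto simp: str.rel_def\<close>)
  next
    assume "fst d \<in> verts g"
    then have "reach ?R (hd es) d" using reach[of "fst d"] es(2) by (cases d) simp
    then show "d \<in> set es" by (rule reach_in_lpath[OF det es(1) fin])
  qed
  then have set: "set es = verts g \<times> {()}" by force
  have "graph_iso g (ed w)"
    by (rule lpath_graph_iso[OF det es(1) fin, of fst])
      (auto simp: set inj_on_def str_rel_iff prod_eq_iff)
  then show "\<exists>w. graph_iso g (ed w)" ..
next
  let ?R = "str.rel g (\<lambda>n. S (2 * n)) :: 'n \<times> unit \<Rightarrow> 'e \<Rightarrow> 'n \<times> unit \<Rightarrow> bool"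
  assume "\<exists>w. graph_iso g (ed w)"
  then obtain w f where f: "ed_iso g w f" by (auto simp: graph_iso_ed_iff)
  obtain u where u: "u \<in> verts g" "f u = 0" using ed_iso_vertex[OF f, of 0] by auto
  obtain v where v: "v \<in> verts g" "f v = length w" using ed_iso_vertex[OF f, of "length w"] by auto
  have "reach ?R (u, ()) (x, ())" if "x \<in> verts g" "f x = i" for x i
    using that
  proof (induction i arbitrary: x)
    case 0
    then have "x = u" using ed_iso_eq_iff[OF f, of x u] u by simp
    then show ?case by simp
  next
    case (Suc i)
    then have i: "i < length w" using ed_iso_le[OF f Suc.prems(1)] by simp
    then obtain y where y: "y \<in> verts g" "f y = i" using ed_iso_vertex[OF f, of i] by auto
    then have "?R (y, ()) (w ! i) (x, ())"
      using Suc.prems i by (simp add: str_rel_iff ed_iso_edge[OF f])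
    then show ?case using Suc.IH[OF y] by (blast intro: rtranclp.rtrancl_into_rtrancl)
  qed
  moreover have "final g v" using v f by (simp add: ed_iso_final)
  moreover have "sat g \<nu> S det_fm"
    using ed_iso_eq_iff[OF f] by (fastforce simp: sat_det_fm ed_iso_edge[OF f])
  ultimately show "sat g \<nu> S string_fm"
    using u v by (auto simp: string_fm_def str.sat_reach_fm)
qed

section \<open>Contraction of silent steps\<close>

definition vis :: "'b option list \<Rightarrow> 'b list" where
  "vis ls = concat (map (\<lambda>l. case l of None \<Rightarrow> [] | Some b \<Rightarrow> [b]) ls)"

lemma vis_simps [simp]: "vis [] = []" "vis (None # ls) = vis ls" "vis (Some b # ls) = b # vis ls"
  by (simp_all add: vis_def)

text \<open>These become the output nodes: each letter is charged to the node that writes it, and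
  the end nodes in \<open>F\<close> supply the one node that \<open>ed z\<close> has beyond its
  letters.\<close>

definition visible :: "('d \<Rightarrow> 'b option \<Rightarrow> 'd \<Rightarrow> bool) \<Rightarrow> 'd set \<Rightarrow> 'd \<Rightarrow> bool" where
  "visible R F d \<longleftrightarrow> d \<in> F \<or> (\<exists>b e. R d (Some b) e)"

definition silent :: "('d \<Rightarrow> 'b option \<Rightarrow> 'd \<Rightarrow> bool) \<Rightarrow> 'd \<Rightarrow> 'd \<Rightarrow> bool" where
  "silent R = (\<lambda>d e. R d None e)\<^sup>*\<^sup>*"

text \<open>Visibility is demanded of the target only; the source is visible because it writes
  \<open>b\<close>.\<close>

definition contract :: "('d \<Rightarrow> 'b option \<Rightarrow> 'd \<Rightarrow> bool) \<Rightarrow> 'd set \<Rightarrow> 'd \<Rightarrow> 'b \<Rightarrow> 'd \<Rightarrow> bool" where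
  "contract R F d b d' \<longleftrightarrow> visible R F d' \<and> (\<exists>e. R d (Some b) e \<and> silent R e d')"

text \<open>A visible node has no silent step: it is a dead end or, by determinism, its only step
  writes a letter. Hence at most one visible node can be reached silently from a given node.\<close>

lemma det_contract:
  assumes det: "det R" and F: "\<And>d l e. d \<in> F \<Longrightarrow> \<not> R d l e"
  shows "det (contract R F)"
proof -
  have no: "\<not> R d None e" if "visible R F d" for d e
    using that F detD[OF det] by (fastforce simp: visible_def)
  have uniq: "x = y" if "silent R e x" "silent R e y" "visible R F x" "visible R F y" for e x y
    using that unfolding silent_def
  proof (induction arbitrary: y rule: converse_rtranclp_induct)
    case base
    from base(1) show ?case
      by (cases rule: converse_rtranclpE) (use no base in auto)
  next
    case (step d e)
    from step.prems(1) show ?case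
    proof (cases rule: converse_rtranclpE)
      case base
      then show ?thesis using no[of d e] step.prems(3) step.hyps(1) by simp
    next
      case (step e')
      then show ?thesis using detD[OF det] \<open>R d None e\<close> \<open>visible R F x\<close> \<open>visible R F y\<close>
        step.IH by blast
    qed
  qed
  show ?thesis
    unfolding det_def contract_def using detD[OF det] uniq by (metis option.inject)
qed

text \<open>Induction along the path: silent steps are dropped, and a letter step puts its source in
  front. The description of \<open>set es\<close> is what allows the node formula to say just
  "reachable and visible".\<close>

lemma lpath_contract:
  assumes det: "det R" and F: "\<And>d l e. d \<in> F \<Longrightarrow> \<not> R d l e"
    and "lpath R ds ls" "last ds \<in> F"
  shows "\<exists>es. lpath (contract R F) es (vis ls) \<and> silent R (hd ds) (hd es) \<and> last es = last ds \<and>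
    set es = {d. reach R (hd ds) d \<and> visible R F d}"
  using assms(3,4)
proof (induction ls arbitrary: ds)
  case Nil
  then obtain d where d: "ds = [d]" by auto
  have "x = d" if "reach R d x" for x
    using that by (cases rule: converse_rtranclpE) (use F Nil d in auto)
  then have "{x. reach R d x \<and> visible R F x} = {d}"
    using Nil d by (auto simp: visible_def)
  then show ?case using d by (intro exI[of _ "[d]"]) (auto simp: silent_def)
next
  case (Cons l ls)
  from Cons.prems(1) obtain d ds' where ds: "ds = d # ds'" "R d l (hd ds')" "lpath R ds' ls"
    by (rule lpath_ConsE)
  have "last ds' \<in> F" using Cons.prems ds lpath_not_Nil[OF ds(3)] by simp
  then obtain es where es: "lpath (contract R F) es (vis ls)" "silent R (hd ds') (hd es)"
    "last es = last ds'" "set es = {d. reach R (hd ds') d \<and> visible R F d}"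
    using Cons.IH[OF ds(3)] by blast
  have reach: "reach R d x \<longleftrightarrow> x = d \<or> reach R (hd ds') x" for x
  proof
    assume "reach R d x"
    then show "x = d \<or> reach R (hd ds') x"
      by (cases rule: converse_rtranclpE) (use detD[OF det ds(2)] in auto)
  next
    assume "x = d \<or> reach R (hd ds') x"
    then show "reach R d x" using ds(2) by (auto intro: converse_rtranclp_into_rtranclp[of _ d])
  qed
  have last: "last ds = last ds'" using ds lpath_not_Nil[OF ds(3)] by simp
  show ?case
  proof (cases l)
    case None
    have "\<not> visible R F d" using ds None detD[OF det] F by (fastforce simp: visible_def)
    then have "set es = {x. reach R d x \<and> visible R F x}" using es(4) reach by auto
    moreover have "silent R d (hd es)" using es(2) ds(2) None unfolding silent_def
      by (meson converse_rtranclp_into_rtranclp)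
    ultimately show ?thesis using es None ds last by (intro exI[of _ es]) auto
  next
    case (Some b)
    have "visible R F d" using ds Some by (auto simp: visible_def)
    moreover have "visible R F (hd es)" using es(4) lpath_not_Nil[OF es(1)]
      by (metis (mono_tags, lifting) hd_in_set mem_Collect_eq)
    ultimately have "lpath (contract R F) (d # es) (b # vis ls)"
      "set (d # es) = {x. reach R d x \<and> visible R F x}"
      using es ds Some reach by (auto simp: lpath_Cons contract_def)
    then show ?thesis using es Some ds last lpath_not_Nil[OF es(1)]
      by (intro exI[of _ "d # es"]) (auto simp: silent_def)
  qed
qed

section \<open>MSO transductions from deterministic runs\<close>

text \<open>Determinism is required on string graphs only, as the domain formula rejects all others.
  End copies are dead ends, so a run stops when it first meets \<open>F\<close>.\<close>

locale run_graph = definable C UNIV E P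
  for C :: "'c set"
    and E :: "'c \<Rightarrow> 'b::finite option \<Rightarrow> 'c \<Rightarrow> nat \<Rightarrow> nat \<Rightarrow> (unit, 'a::finite) mso"
    and P :: "(nat, unit, 'a) graph \<Rightarrow> (nat \<Rightarrow> nat set) \<Rightarrow> nat \<times> 'c \<Rightarrow> 'b option \<Rightarrow> nat \<times> 'c \<Rightarrow> bool" +
  fixes c0 :: 'c and F :: "'c set"
  assumes c0: "c0 \<in> C" and F: "F \<subseteq> C"
    and det_rel: "\<And>g w f S. ed_iso g w f \<Longrightarrow> det (rel g S)"
    and no_step: "\<And>g S u c l e. c \<in> F \<Longrightarrow> \<not> rel g S (u, c) l e"
begin

text \<open>Admitting only the label \<open>None\<close> yields a formula for reachability by silent
  steps.\<close>

sublocale sil: definable C "{None}" E P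
  by unfold_locales (use finite_C sat_E fv1_E in auto)

lemma reach_sil: "reach (sil.rel g S) = silent (rel g S)"
  by (simp add: silent_def rel_def sil.rel_def)

lemma finite_F: "finite F"
  using F finite_C by (rule finite_subset)

definition reachable_fm :: "'c \<Rightarrow> nat \<Rightarrow> (unit, 'a) mso" where
  "reachable_fm c x = Ex1 (Suc x) (Conj (first_fm (Suc x)) (reach_fm c0 c (Suc x) x))"

definition visible_fm :: "'c \<Rightarrow> nat \<Rightarrow> (unit, 'a) mso" where
  "visible_fm c x = (if c \<in> F then TT else
     Disjs UNIV (\<lambda>b. Disjs C (\<lambda>c'. Ex1 (Suc x) (E c (Some b) c' x (Suc x)))))"

definition contract_fm :: "'c \<Rightarrow> 'b \<Rightarrow> 'c \<Rightarrow> (unit, 'a) mso" where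
  "contract_fm c b c' = Disjs C (\<lambda>c1. Ex1 2 (Conj (E c (Some b) c1 0 2) (sil.reach_fm c1 c' 2 1)))"

text \<open>Copy names are decoded by disjunctions over the copies with that code. Output node
  labels are of type \<open>unit\<close>, so having exactly one label means satisfying the node
  formula. Parameters whose run does not reach an end copy are excluded by the domain
  formula.\<close>

definition trans :: "(unit, 'a, unit, 'b) mso_trans" where
  "trans = \<lparr> tdom = Conj string_fm (Ex1 0 (Conj (first_fm 0) (Disjs F (\<lambda>c. Ex1 1 (reach_fm c0 c 0 1))))),
     copies = enc C ` C,
     nodef = \<lambda>n _. Disjs {c \<in> C. enc C c = n} (\<lambda>c. Conj (reachable_fm c 0) (visible_fm c 0)),
     edgef = \<lambda>n n' b. Disjs {c \<in> C. enc C c = n} (\<lambda>c. Disjs {c' \<in> C. enc C c' = n'} (contract_fm c b)) \<rparr>"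

lemma copies_trans [simp]: "copies trans = enc C ` C"
  by (simp add: trans_def)

lemma mso_trans_wf_trans: "mso_trans_wf trans"
proof -
  have "fv1 (E c (Some b) c' 0 (Suc 0)) - {Suc 0} \<subseteq> {0}" for c b c'
    using fv1_E[of c "Some b" c' 0 "Suc 0"] by auto
  then have vis: "fv1 (visible_fm c 0) \<subseteq> {0}" for c
    by (simp add: visible_fm_def finite_C) blast
  have re: "fv1 (reachable_fm c 0) \<subseteq> {0}" for c
    by (auto simp: reachable_fm_def fv1_reach_fm)
  have "fv1 (E c (Some b) c' 0 2) - {2} \<subseteq> {0}" for c b c'
    using fv1_E[of c "Some b" c' 0 2] by auto
  then have con: "fv1 (contract_fm c b c') \<subseteq> {0, 1}" for c b c'
    by (simp add: contract_fm_def finite_C sil.fv1_reach_fm) blast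
  have "fv1 (nodef trans n l) \<subseteq> {0}" for n l
    using vis re by (simp add: trans_def finite_C UN_subset_iff)
  moreover have "fv1 (edgef trans n n' b) \<subseteq> {0, 1}" for n n' b
    using con by (simp add: trans_def finite_C UN_subset_iff)
  moreover have "fv1 (tdom trans) = {}"
    by (simp add: trans_def finite_F fv1_string_fm fv1_reach_fm) blast
  moreover have "finite (copies trans)" by (simp add: trans_def finite_C)
  ultimately show ?thesis by (simp add: mso_trans_wf_def)
qed

context
  fixes g :: "(nat, unit, 'a) graph" and S :: "nat \<Rightarrow> nat set"
begin

abbreviation "R \<equiv> rel g (\<lambda>n. S (2 * n))"

lemma sat_tdom:
  "sat g \<nu> S (tdom trans) \<longleftrightarrow> (\<exists>w. graph_iso g (ed w)) \<and>
    (\<exists>u \<in> verts g. first g u \<and> (\<exists>v \<in> verts g. \<exists>c \<in> F. reach R (u, c0) (v, c)))"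
  using F by (auto simp: trans_def sat_string_fm finite_F sat_reach_fm c0 subset_iff)

lemma sat_nodef:
  assumes "u \<in> verts g" "c \<in> C"
  shows "sat g (asg1 u u') S (nodef trans (enc C c) l) \<longleftrightarrow>
    (\<exists>v \<in> verts g. first g v \<and> reach R (v, c0) (u, c)) \<and> visible R {d. snd d \<in> F} (u, c)"
proof -
  have "{c' \<in> C. enc C c' = enc C c} = {c}"
    using inj_on_enc[OF finite_C] assms by (auto dest: inj_onD)
  moreover have "sat g (asg1 u u') S (reachable_fm c 0) \<longleftrightarrow>
      (\<exists>v \<in> verts g. first g v \<and> reach R (v, c0) (u, c))"
    using assms c0 by (auto simp: reachable_fm_def sat_reach_fm asg1_def)
  moreover have "sat g (asg1 u u') S (visible_fm c 0) \<longleftrightarrow> visible R {d. snd d \<in> F} (u, c)"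
    using assms by (auto simp: visible_fm_def visible_def finite_C sat_E rel_def asg1_def)
  ultimately show ?thesis by (simp add: trans_def)
qed

text \<open>\<open>contract_fm\<close> does not test the target for visibility;
  \<open>out_graph\<close> takes edges between output nodes only, and these are visible.\<close>

lemma sat_edgef:
  assumes "u \<in> verts g" "c \<in> C" "u' \<in> verts g" "c' \<in> C" "visible R {d. snd d \<in> F} (u', c')"
  shows "sat g (asg1 u u') S (edgef trans (enc C c) (enc C c') b) \<longleftrightarrow>
    contract R {d. snd d \<in> F} (u, c) b (u', c')"
proof -
  have "{a \<in> C. enc C a = enc C c} = {c}" "{a \<in> C. enc C a = enc C c'} = {c'}"
    using inj_on_enc[OF finite_C] assms by (auto dest: inj_onD)
  then have "sat g (asg1 u u') S (edgef trans (enc C c) (enc C c') b) \<longleftrightarrow>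
      sat g (asg1 u u') S (contract_fm c b c')"
    by (simp add: trans_def)
  also have "\<dots> \<longleftrightarrow> (\<exists>c1\<in>C. \<exists>v\<in>verts g. P g (\<lambda>n. S (2 * n)) (u, c) (Some b) (v, c1) \<and>
      silent R (v, c1) (u', c'))"
    using assms by (auto simp: contract_fm_def finite_C sat_E sil.sat_reach_fm asg1_def reach_sil)
  also have "\<dots> \<longleftrightarrow> contract R {d. snd d \<in> F} (u, c) b (u', c')"
    using assms by (auto simp: contract_def rel_def)
  finally show ?thesis .
qed

text \<open>Up to the coding of copies, the output graph is the contracted run: its nodes are the
  reachable visible ones, its edges the contracted steps. So \<open>lpath_graph_iso\<close>
  applies.\<close>

lemma out_graph_trans:
  assumes f: "ed_iso g w f" and u: "u \<in> verts g" "f u = 0"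
    and ds: "lpath R ds ls" "hd ds = (u, c0)" "snd (last ds) \<in> F"
  shows "graph_iso (out_graph trans g S) (ed (vis ls))"
proof -
  let ?F = "{d. snd d \<in> F}"
  have det: "det R" using det_rel[OF f] .
  have no: "\<not> R d l e" if "d \<in> ?F" for d l e
    using no_step that by (cases d) auto
  obtain es where es: "lpath (contract R ?F) es (vis ls)" "last es = last ds"
    "set es = {d. reach R (u, c0) d \<and> visible R ?F d}"
    using lpath_contract[where F = ?F, OF det no ds(1)] ds(2,3) by auto
  have first: "first g v \<longleftrightarrow> v = u" if "v \<in> verts g" for v
    using ed_iso_first[OF f that] ed_iso_eq_iff[OF f that u(1)] u(2) by simp
  have in_C: "d \<in> verts g \<times> C" if "reach R (u, c0) d" for d
    using that by (cases rule: rtranclp.cases) (use u c0 in \<open>auto simp: rel_def\<close>)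
  let ?k = "\<lambda>(v, c). (v, enc C c)"
  have node: "sat g (asg1 v v) S (nodef trans (enc C c) ()) \<longleftrightarrow> (v, c) \<in> set es"
    if "v \<in> verts g" "c \<in> C" for v c
    using that by (auto simp: sat_nodef es(3) first u)
  have verts: "verts (out_graph trans g S) = ?k ` set es"
  proof (intro set_eqI iffI)
    fix x assume "x \<in> verts (out_graph trans g S)"
    then obtain v c where "x = (v, enc C c)" "v \<in> verts g" "c \<in> C" "(v, c) \<in> set es"
      using node by (auto simp: out_graph_def)
    then show "x \<in> ?k ` set es" by force
  next
    fix x assume "x \<in> ?k ` set es"
    then obtain v c where x: "x = (v, enc C c)" "(v, c) \<in> set es" by auto
    then have "v \<in> verts g" "c \<in> C" using es(3) in_C by auto
    then show "x \<in> verts (out_graph trans g S)" using x node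
      by (auto simp: out_graph_def Let_def)
  qed
  show ?thesis
  proof (rule lpath_graph_iso[OF det_contract[OF det no] es(1) _ _ verts])
    show "\<not> contract R ?F (last es) l e" for l e
      using no ds(3) es(2) by (auto simp: contract_def)
    show "inj_on ?k (set es)"
      using inj_on_enc[OF finite_C] es(3) in_C by (auto simp: inj_on_def)
  next
    fix x y b assume xy: "x \<in> set es" "y \<in> set es"
    then have xyC: "x \<in> verts g \<times> C" "y \<in> verts g \<times> C" using es(3) in_C by auto
    have "?k x \<in> verts (out_graph trans g S)" "?k y \<in> verts (out_graph trans g S)"
      using xy by (simp_all add: verts)
    then have "(?k x, b, ?k y) \<in> edges (out_graph trans g S) \<longleftrightarrow>
        sat g (asg1 (fst x) (fst y)) S (edgef trans (enc C (snd x)) (enc C (snd y)) b)"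
      by (auto simp: out_graph_def Let_def split_beta)
    also have "\<dots> \<longleftrightarrow> contract R ?F x b y"
      using sat_edgef[of "fst x" "snd x" "fst y" "snd y" b] xyC xy(2) es(3) by (simp add: mem_Times_iff)
    finally show "(?k x, b, ?k y) \<in> edges (out_graph trans g S) \<longleftrightarrow> contract R ?F x b y" .
  qed simp
qed

end

text \<open>Soundness is demanded for every assignment whose run happens to reach \<open>F\<close>,
  completeness for one suitable assignment.\<close>

lemma NMSO_edI:
  assumes sound: "\<And>g w f S u ds ls. ed_iso g w f \<Longrightarrow> u \<in> verts g \<Longrightarrow> f u = 0 \<Longrightarrow>
      lpath (rel g S) ds ls \<Longrightarrow> hd ds = (u, c0) \<Longrightarrow> snd (last ds) \<in> F \<Longrightarrow> (w, vis ls) \<in> m"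
    and complete: "\<And>g w f z u. (w, z) \<in> m \<Longrightarrow> ed_iso g w f \<Longrightarrow> u \<in> verts g \<Longrightarrow> f u = 0 \<Longrightarrow>
      \<exists>S ds ls. (\<forall>n. S n \<subseteq> verts g) \<and> lpath (rel g S) ds ls \<and> hd ds = (u, c0) \<and>
        snd (last ds) \<in> F \<and> vis ls = z"
  shows "m \<in> NMSO_ed"
proof -
  have 1: "\<exists>w z. (w, z) \<in> m \<and> graph_iso g (ed w) \<and> graph_iso h (ed z)"
    if "h \<in> mso_out trans g" for g :: "(nat, unit, 'a) graph" and h
  proof -
    from that obtain S where h: "h = out_graph trans g S" "sat g (\<lambda>_. undefined) S (tdom trans)"
      by (auto simp: mso_out_def)
    then obtain w f u v c where f: "ed_iso g w f" and u: "u \<in> verts g" "first g u"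
      and reach: "reach (R g S) (u, c0) (v, c)" and c: "c \<in> F"
      by (auto simp: sat_tdom graph_iso_ed_iff)
    from reach obtain ds ls where ds: "lpath (R g S) ds ls" "hd ds = (u, c0)" "last ds = (v, c)"
      by (rule reach_lpath)
    have "f u = 0" using ed_iso_first[OF f u(1)] u(2) by simp
    then have "(w, vis ls) \<in> m" "graph_iso h (ed (vis ls))"
      using sound[OF f u(1) _ ds(1,2)] out_graph_trans[OF f u(1) _ ds(1,2)] ds(3) c h by auto
    then show ?thesis using f by (auto simp: graph_iso_ed_iff[of g])
  qed
  have 2: "\<exists>h \<in> mso_out trans g. graph_iso h (ed z)"
    if m: "(w, z) \<in> m" and iso: "graph_iso g (ed w)" for g :: "(nat, unit, 'a) graph" and w z
  proof -
    from iso obtain f where f: "ed_iso g w f" by (auto simp: graph_iso_ed_iff)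
    obtain u where u: "u \<in> verts g" "f u = 0" using ed_iso_vertex[OF f, of 0] by auto
    from complete[OF m f u] obtain S ds ls where S: "\<And>n. S n \<subseteq> verts g"
      and ds: "lpath (rel g S) ds ls" "hd ds = (u, c0)" "snd (last ds) \<in> F" and ls: "vis ls = z"
      by blast
    \<comment> \<open>The formulas read parameter \<open>n\<close> from the set variable
      \<open>2 * n\<close>; the odd variables are quantified and get a default value.\<close>
    define S' where "S' X = (if even X then S (X div 2) else {})" for X
    have S': "(\<lambda>n. S' (2 * n)) = S" by (simp add: S'_def)
    have last: "last ds \<in> set ds" using lpath_not_Nil[OF ds(1)] by simp
    have reach: "reach (rel g S) (u, c0) (last ds)" using lpath_reach[OF ds(1) last] ds(2) by simp
    have "fst (last ds) \<in> verts g"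
      using reach by (cases rule: rtranclp.cases) (use u in \<open>auto simp: rel_def\<close>)
    then have "sat g (\<lambda>_. undefined) S' (tdom trans)"
      unfolding sat_tdom S' using iso u ds(3) reach ed_iso_first[OF f u(1)]
      by (metis prod.collapse)
    moreover have "S' X \<subseteq> verts g" for X using S by (simp add: S'_def)
    ultimately have "out_graph trans g S' \<in> mso_out trans g" by (auto simp: mso_out_def)
    moreover have "graph_iso (out_graph trans g S') (ed z)"
      using out_graph_trans[OF f u, of S'] ds ls unfolding S' by blast
    ultimately show ?thesis by blast
  qed
  show ?thesis
    unfolding NMSO_ed_def using mso_trans_wf_trans 1 2 by blast
qed

end

section \<open>Computations of 2gsm's\<close>

definition act :: "('a, 'b) instr \<Rightarrow> bool \<Rightarrow> nat \<times> 'b list \<times> int" where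
  "act t s = (case t of (p, \<sigma>, q1, \<alpha>1, e1, q0, \<alpha>0, e0) \<Rightarrow> if s then (q1, \<alpha>1, e1) else (q0, \<alpha>0, e0))"

abbreviation sym :: "('a, 'b) instr \<Rightarrow> 'a tsym" where
  "sym t \<equiv> fst (snd t)"

definition exec :: "'a list \<Rightarrow> nat \<times> 'b list \<times> int \<Rightarrow> nat \<times> nat \<Rightarrow> 'b list \<Rightarrow> nat \<times> nat \<Rightarrow> bool" where
  "exec w a d \<alpha> d' \<longleftrightarrow> (case a of (q, \<beta>, e) \<Rightarrow>
     fst d' = q \<and> \<alpha> = \<beta> \<and> int (snd d') = int (snd d) + e \<and> snd d' \<le> length w + 1)"

text \<open>The output moves from the configuration into the label. What remains is the pair of
  state and position, so a repeated pair is a loop that can be pumped or cut out.\<close>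

definition gstep :: "('a, 'b) gsm \<Rightarrow> 'a list \<Rightarrow> nat \<times> nat \<Rightarrow> 'b list \<Rightarrow> nat \<times> nat \<Rightarrow> bool" where
  "gstep M w d \<alpha> d' \<longleftrightarrow> (\<exists>t\<in>delta M. fst t = fst d \<and> exec w (act t (tape w (snd d) = sym t)) d \<alpha> d')"

lemma gsm_step_iff:
  "gsm_step M w (p, i, z) (p', i', z') \<longleftrightarrow> (\<exists>\<alpha>. z' = z @ \<alpha> \<and> gstep M w (p, i) \<alpha> (p', i'))"
proof -
  have *: "(case t of (p0, \<sigma>, q1, \<alpha>1, e1, q0, \<alpha>0, e0) \<Rightarrow> p0 = p \<and>
      (if tape w i = \<sigma> then p' = q1 \<and> z' = z @ \<alpha>1 \<and> int i' = int i + e1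
       else p' = q0 \<and> z' = z @ \<alpha>0 \<and> int i' = int i + e0)) \<longleftrightarrow>
    fst t = p \<and> (case act t (tape w i = sym t) of (q, \<beta>, e) \<Rightarrow>
      p' = q \<and> z' = z @ \<beta> \<and> int i' = int i + e)" for t :: "('a, 'b) instr"
    by (simp add: act_def split_beta)
  show ?thesis
    unfolding gsm_step_def gstep_def exec_def prod.case * by (auto simp: split_beta)
qed

definition conf :: "'b conf \<Rightarrow> nat \<times> nat" where
  "conf c = (fst c, fst (snd c))"

definition accepts :: "('a, 'b) gsm \<Rightarrow> 'a list \<Rightarrow> (nat \<times> nat) list \<Rightarrow> 'b list list \<Rightarrow> bool" where
  "accepts M w es \<alpha>s \<longleftrightarrow> lpath (gstep M w) es \<alpha>s \<and> hd es = (q_in M, 0) \<and> fst (last es) = q_f M"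

text \<open>The equation \<open>map conf cs = es\<close> carries distinctness of \<open>es\<close>
  over to \<open>cs\<close>, where visits are counted.\<close>

lemma accepts_succ:
  assumes "accepts M w es \<alpha>s" shows "\<exists>cs. gsm_succ M w (concat \<alpha>s) cs \<and> map conf cs = es"
proof -
  have path: "lpath (gstep M w) es \<alpha>s" and hd: "hd es = (q_in M, 0)" and last: "fst (last es) = q_f M"
    using assms by (auto simp: accepts_def)
  have len: "length es = Suc (length \<alpha>s)" using path by (simp add: lpath_def)
  have ne: "es \<noteq> []" using len by auto
  let ?c = "\<lambda>n. (fst (es ! n), snd (es ! n), concat (take n \<alpha>s))"
  let ?cs = "map ?c [0..<length es]"
  have "gsm_step M w (?c n) (?c (Suc n))" if "n < length \<alpha>s" for n
    using that path by (auto simp: gsm_step_iff take_Suc_conv_app_nth lpath_def)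
  moreover have "hd ?cs = (q_in M, 0, [])"
    using ne hd by (simp add: hd_map hd_conv_nth[symmetric] del: upt_Suc)
  ultimately have "gsm_comp M w ?cs"
    using ne len by (simp add: gsm_comp_def del: upt_Suc)
  moreover have "last ?cs = (fst (last es), snd (last es), concat \<alpha>s)"
    using len ne by (simp add: last_conv_nth)
  ultimately have "gsm_succ M w (concat \<alpha>s) ?cs"
    using last by (simp add: gsm_succ_def)
  moreover have "map conf ?cs = es"
    by (rule nth_equalityI) (simp_all add: conf_def del: upt_Suc)
  ultimately show ?thesis by blast
qed

lemma succ_accepts:
  assumes "gsm_succ M w z cs" shows "\<exists>\<alpha>s. accepts M w (map conf cs) \<alpha>s \<and> z = concat \<alpha>s"
proof -
  have ne: "cs \<noteq> []" and hd: "hd cs = (q_in M, 0, [])"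
    and step: "\<And>n. Suc n < length cs \<Longrightarrow> gsm_step M w (cs ! n) (cs ! Suc n)"
    and last: "fst (last cs) = q_f M" "snd (snd (last cs)) = z"
    using assms by (auto simp: gsm_succ_def gsm_comp_def)
  have "\<exists>\<alpha>. snd (snd (cs ! Suc n)) = snd (snd (cs ! n)) @ \<alpha> \<and>
      gstep M w (conf (cs ! n)) \<alpha> (conf (cs ! Suc n))" if "Suc n < length cs" for n
    using step[OF that] by (cases "cs ! n"; cases "cs ! Suc n") (auto simp: gsm_step_iff conf_def)
  then obtain \<alpha> where \<alpha>: "\<And>n. Suc n < length cs \<Longrightarrow>
      snd (snd (cs ! Suc n)) = snd (snd (cs ! n)) @ \<alpha> n \<and>
      gstep M w (conf (cs ! n)) (\<alpha> n) (conf (cs ! Suc n))" by metis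
  let ?\<alpha>s = "map \<alpha> [0..<length cs - 1]"
  have out: "n < length cs \<Longrightarrow> snd (snd (cs ! n)) = concat (map \<alpha> [0..<n])" for n
  proof (induction n)
    case 0
    then show ?case using hd ne by (simp add: hd_conv_nth)
  next
    case (Suc n)
    then show ?case using \<alpha>[of n] by simp
  qed
  have "z = concat ?\<alpha>s"
    using out[of "length cs - 1"] ne last by (simp add: last_conv_nth)
  moreover have "accepts M w (map conf cs) ?\<alpha>s"
    unfolding accepts_def lpath_def
  proof (intro conjI allI impI)
    fix n assume "n < length ?\<alpha>s"
    then have "Suc n < length cs" by simp
    then show "gstep M w (map conf cs ! n) (?\<alpha>s ! n) (map conf cs ! Suc n)"
      using \<alpha>[of n] by simp
  qed (use ne hd last in \<open>simp_all add: hd_map last_map conf_def\<close>)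
  ultimately show ?thesis by blast
qed

lemma gsm_rel_iff: "(w, z) \<in> gsm_rel M \<longleftrightarrow> (\<exists>es \<alpha>s. accepts M w es \<alpha>s \<and> z = concat \<alpha>s)"
  unfolding gsm_rel_def using accepts_succ succ_accepts by blast

text \<open>A loop with nonempty output could be pumped beyond the bound, so every loop is silent
  and can be cut out.\<close>

lemma bounded_output_distinct:
  fixes R :: "'d \<Rightarrow> 'b list \<Rightarrow> 'd \<Rightarrow> bool"
  assumes bound: "\<And>es \<alpha>s. lpath R es \<alpha>s \<Longrightarrow> hd es = s \<Longrightarrow> last es \<in> F \<Longrightarrow> length (concat \<alpha>s) \<le> B"
    and "lpath R es \<alpha>s" "hd es = s" "last es \<in> F"
  shows "\<exists>es' \<alpha>s'. lpath R es' \<alpha>s' \<and> hd es' = s \<and> last es' \<in> F \<and> concat \<alpha>s' = concat \<alpha>s \<and> distinct es'"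
  using assms(2-4)
proof (induction "length es" arbitrary: es \<alpha>s rule: less_induct)
  case less
  show ?case
  proof (cases "distinct es")
    case True
    then show ?thesis using less.prems by blast
  next
    case False
    then obtain i j where ij: "i < j" "j < length es" "es ! i = es ! j"
      by (metis distinct_conv_nth nat_neq_iff)
    have len: "length es = Suc (length \<alpha>s)" using less.prems(1) by (simp add: lpath_def)
    \<comment> \<open>Prefix, loop and rest share the repeated vertex \<open>es ! j\<close>, so
      \<open>lpath_append\<close> can glue them with any number of loops, including none.\<close>
    define A where "A = take (Suc i) es"
    define Lp where "Lp = drop i (take (Suc j) es)"
    define D where "D = drop j es"
    define y where "y = drop i (take j \<alpha>s)"
    have A: "lpath R A (take i \<alpha>s)" "hd A = s" "last A = es ! j"
      using lpath_take[OF less.prems(1), of i] ij less.prems(2)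
      by (auto simp: A_def take_Suc_conv_app_nth hd_append) (metis hd_conv_nth len length_0_conv nat.distinct(1))
    have Lp: "lpath R Lp y" "hd Lp = es ! j" "last Lp = es ! j"
      using lpath_drop[OF lpath_take[OF less.prems(1), of j], of i] ij
      by (auto simp: Lp_def y_def hd_drop_conv_nth last_conv_nth)
    have D: "lpath R D (drop j \<alpha>s)" "hd D = es ! j" "last D \<in> F"
      using lpath_drop[OF less.prems(1), of j] ij less.prems(3) by (auto simp: D_def hd_drop_conv_nth)
    have last_join: "last (xs @ tl zs) = last zs" if "last xs = hd zs" "xs \<noteq> []" "zs \<noteq> []" for xs zs :: "'d list"
      using that by (cases zs) auto
    have hd_join: "hd (xs @ tl zs) = hd xs" if "xs \<noteq> []" for xs zs :: "'d list"
      using that by simp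
    have ne: "A \<noteq> []" "Lp \<noteq> []" "D \<noteq> []" using A Lp D lpath_not_Nil by blast+
    have "concat y = []"
    proof (rule ccontr)
      assume y: "concat y \<noteq> []"
      \<comment> \<open>Each further turn through \<open>Lp\<close> adds at least one letter, so the
        output before leaving the loop can be made arbitrarily long.\<close>
      have "\<exists>xs ls. lpath R xs ls \<and> hd xs = s \<and> last xs = es ! j \<and> n \<le> length (concat ls)" for n
      proof (induction n)
        case 0
        then show ?case using A by blast
      next
        case (Suc n)
        then obtain xs ls where xs: "lpath R xs ls" "hd xs = s" "last xs = es ! j" "n \<le> length (concat ls)"
          by blast
        moreover have "1 \<le> length (concat y)" using y by (cases "concat y") auto
        ultimately have "lpath R (xs @ tl Lp) (ls @ y)" "hd (xs @ tl Lp) = s"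
          "last (xs @ tl Lp) = es ! j" "Suc n \<le> length (concat (ls @ y))"
          using lpath_append[OF xs(1) Lp(1)] Lp hd_join last_join ne lpath_not_Nil[OF xs(1)]
          by auto
        then show ?case by blast
      qed
      then obtain xs ls where xs: "lpath R xs ls" "hd xs = s" "last xs = es ! j" "Suc B \<le> length (concat ls)"
        by blast
      then have "lpath R (xs @ tl D) (ls @ drop j \<alpha>s)" "hd (xs @ tl D) = s" "last (xs @ tl D) \<in> F"
        using lpath_append[OF xs(1) D(1)] D hd_join last_join ne lpath_not_Nil[OF xs(1)] by auto
      from bound[OF this] show False using xs(4) by simp
    qed
    moreover have "\<alpha>s = take i \<alpha>s @ y @ drop j \<alpha>s"
      using ij(1) by (metis append_take_drop_id append_assoc less_imp_le_nat min.absorb1 take_take y_def)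
    ultimately have out: "concat (take i \<alpha>s @ drop j \<alpha>s) = concat \<alpha>s"
      by (metis append_Nil concat_append)
    have "lpath R (A @ tl D) (take i \<alpha>s @ drop j \<alpha>s)" "hd (A @ tl D) = s" "last (A @ tl D) \<in> F"
      using lpath_append[OF A(1) D(1)] A D hd_join last_join ne by auto
    moreover have "length (A @ tl D) < length es"
      using ij by (auto simp: A_def D_def)
    ultimately show ?thesis using less.hyps[of "A @ tl D"] out by metis
  qed
qed

lemma bounded_accepts_distinct:
  assumes "\<And>z. (w, z) \<in> gsm_rel M \<Longrightarrow> length z \<le> B" "(w, z) \<in> gsm_rel M"
  shows "\<exists>es \<alpha>s. accepts M w es \<alpha>s \<and> z = concat \<alpha>s \<and> distinct es"
proof -
  from assms(2) obtain es \<alpha>s where es: "accepts M w es \<alpha>s" "z = concat \<alpha>s"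
    by (auto simp: gsm_rel_iff)
  have "\<exists>es' \<alpha>s'. lpath (gstep M w) es' \<alpha>s' \<and> hd es' = (q_in M, 0) \<and> last es' \<in> {d. fst d = q_f M} \<and>
      concat \<alpha>s' = concat \<alpha>s \<and> distinct es'"
    by (rule bounded_output_distinct[where es = es and B = B])
      (use assms(1) es in \<open>auto simp: gsm_rel_iff accepts_def\<close>)
  then show ?thesis using es(2) unfolding accepts_def by fastforce
qed

lemma wf_delta:
  assumes "gsm_wf M" "t \<in> delta M" "act t s = (q, \<alpha>, e)"
  shows "fst t \<in> states M" "fst t \<noteq> q_f M" "q \<in> states M" "e \<in> {-1, 0, 1}"
proof -
  have *: "\<forall>t\<in>delta M. case t of (p, \<sigma>, q1, \<alpha>1, e1, q0, \<alpha>0, e0) \<Rightarrow>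
      p \<in> states M \<and> q1 \<in> states M \<and> q0 \<in> states M \<and> p \<noteq> q_f M \<and>
        e1 \<in> {-1, 0, 1} \<and> e0 \<in> {-1, 0, 1}"
    using assms(1) unfolding gsm_wf_def by (elim conjE)
  show "fst t \<in> states M" "fst t \<noteq> q_f M" "q \<in> states M" "e \<in> {-1, 0, 1}"
    using bspec[OF * assms(2)] assms(3) by (simp_all add: act_def split_beta split: if_splits)
qed

section \<open>Output bounds from finite visit and from mso definability\<close>

definition max_out :: "('a, 'b) gsm \<Rightarrow> nat" where
  "max_out M = Max (insert 0 ((\<lambda>(t, s). length (fst (snd (act t s)))) ` (delta M \<times> UNIV)))"

lemma max_out:
  assumes "gsm_wf M" "t \<in> delta M" "act t s = (q, \<alpha>, e)" shows "length \<alpha> \<le> max_out M"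
proof -
  have "finite (delta M)" using assms(1) by (simp add: gsm_wf_def)
  moreover have "length \<alpha> \<in> (\<lambda>(t, s). length (fst (snd (act t s)))) ` (delta M \<times> UNIV)"
    using assms(2,3) by (auto intro!: image_eqI[of _ _ "(t, s)"])
  ultimately show ?thesis unfolding max_out_def by (intro Max_ge) auto
qed

lemma gstep_bounds:
  assumes "gsm_wf M" "gstep M w d \<alpha> d'"
  shows "length \<alpha> \<le> max_out M" "fst d \<in> states M" "fst d' \<in> states M" "snd d' \<le> length w + 1"
proof -
  obtain t where t0: "t \<in> delta M" "fst t = fst d"
    "exec w (act t (tape w (snd d) = sym t)) d \<alpha> d'"
    using assms(2) unfolding gstep_def by blast
  obtain q e where t: "t \<in> delta M" "act t (tape w (snd d) = sym t) = (q, \<alpha>, e)"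
    "fst t = fst d" "fst d' = q" "snd d' \<le> length w + 1"
    using t0 by (cases "act t (tape w (snd d) = sym t)") (auto simp: exec_def)
  then show "length \<alpha> \<le> max_out M" "fst d \<in> states M" "fst d' \<in> states M" "snd d' \<le> length w + 1"
    using max_out[OF assms(1) t(1,2)] wf_delta[OF assms(1) t(1,2)] t(3-5) by auto
qed

lemma accepts_bounds:
  assumes "gsm_wf M" "accepts M w es \<alpha>s" "d \<in> set es"
  shows "fst d \<in> states M" "snd d \<le> length w + 1"
proof -
  have path: "lpath (gstep M w) es \<alpha>s" and hd: "hd es = (q_in M, 0)"
    using assms(2) by (auto simp: accepts_def)
  obtain n where n: "n < length es" "d = es ! n" using assms(3) by (auto simp: in_set_conv_nth)
  have "fst d \<in> states M \<and> snd d \<le> length w + 1"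
  proof (cases n)
    case 0
    then have "d = (q_in M, 0)" using n hd by (metis hd_conv_nth length_greater_0_conv)
    then show ?thesis using assms(1) by (simp add: gsm_wf_def)
  next
    case (Suc m)
    then have "gstep M w (es ! m) (\<alpha>s ! m) d" using path n by (auto simp: lpath_def)
    then show ?thesis using gstep_bounds[OF assms(1)] by blast
  qed
  then show "fst d \<in> states M" "snd d \<le> length w + 1" by auto
qed

text \<open>The tape has \<open>length w + 2\<close> positions, each visited at most
  \<open>k\<close> times, and one step writes at most \<open>max_out M\<close> letters.\<close>

lemma k_visiting_bound:
  assumes wf: "gsm_wf M" and succ: "gsm_succ M w z cs" and k: "k_visiting k cs"
  shows "length z \<le> k * (length w + 2) * max_out M"
proof -
  obtain \<alpha>s where \<alpha>s: "accepts M w (map conf cs) \<alpha>s" "z = concat \<alpha>s"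
    using succ_accepts[OF succ] by blast
  have len: "length cs = Suc (length \<alpha>s)" using \<alpha>s(1) by (simp add: accepts_def lpath_def)
  have "fst (snd (cs ! n)) \<le> length w + 1" if "n < length cs" for n
    using accepts_bounds(2)[OF wf \<alpha>s(1), of "conf (cs ! n)"] that by (simp add: conf_def)
  then have "{..<length cs} = (\<Union>j\<le>length w + 1. {n. n < length cs \<and> fst (snd (cs ! n)) = j})"
    by auto
  then have "length cs = card (\<Union>j\<le>length w + 1. {n. n < length cs \<and> fst (snd (cs ! n)) = j})"
    by (metis card_lessThan)
  also have "\<dots> \<le> (\<Sum>j\<le>length w + 1. card {n. n < length cs \<and> fst (snd (cs ! n)) = j})"
    by (rule card_UN_le) simp
  also have "\<dots> \<le> (\<Sum>j\<le>length w + 1. k)"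
    by (rule sum_mono) (use k in \<open>simp add: k_visiting_def\<close>)
  finally have cs: "length cs \<le> k * (length w + 2)" by (simp add: algebra_simps)
  have "\<alpha> \<in> set \<alpha>s \<Longrightarrow> length \<alpha> \<le> max_out M" for \<alpha>
    using \<alpha>s(1) gstep_bounds(1)[OF wf] unfolding accepts_def lpath_def by (metis in_set_conv_nth)
  then have "length (concat \<alpha>s) \<le> length \<alpha>s * max_out M"
    unfolding length_concat using sum_list_mono[of \<alpha>s length "\<lambda>_. max_out M"]
    by (simp add: sum_list_triv)
  also have "\<dots> \<le> k * (length w + 2) * max_out M"
    using cs len by (intro mult_right_mono) auto
  finally show ?thesis using \<alpha>s(2) by simp
qed

lemma bounded_finite_visit:
  assumes wf: "gsm_wf M" and bound: "\<And>w z. (w, z) \<in> gsm_rel M \<Longrightarrow> length z \<le> B w"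
  shows "finite_visit M"
  unfolding finite_visit_def
proof (intro exI[of _ "card (states M)"] ballI, clarify)
  fix w z assume "(w, z) \<in> gsm_rel M"
  then obtain es \<alpha>s where es: "accepts M w es \<alpha>s" "z = concat \<alpha>s" "distinct es"
    using bounded_accepts_distinct[OF bound] by blast
  obtain cs where cs: "gsm_succ M w z cs" "map conf cs = es"
    using accepts_succ[OF es(1)] es(2) by blast
  have "card {n. n < length cs \<and> fst (snd (cs ! n)) = j} \<le> card (states M)" for j
  proof (rule card_inj_on_le)
    have nth: "conf (cs ! n) = es ! n" if "n < length cs" for n using cs(2) that by auto
    show "inj_on (\<lambda>n. fst (cs ! n)) {n. n < length cs \<and> fst (snd (cs ! n)) = j}"
    proof (rule inj_onI, clarify)
      fix n m assume "n < length cs" "m < length cs" "fst (cs ! n) = fst (cs ! m)"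
        "j = fst (snd (cs ! n))" "fst (snd (cs ! m)) = fst (snd (cs ! n))"
      then have "es ! n = es ! m" using nth[of n] nth[of m] by (simp add: conf_def)
      then show "n = m" using es(3) cs(2) \<open>n < length cs\<close> \<open>m < length cs\<close>
        by (metis length_map nth_eq_iff_index_eq)
    qed
    show "(\<lambda>n. fst (cs ! n)) ` {n. n < length cs \<and> fst (snd (cs ! n)) = j} \<subseteq> states M"
      using accepts_bounds(1)[OF wf es(1)] cs(2) by (force simp: conf_def)
    show "finite (states M)" using wf by (simp add: gsm_wf_def)
  qed
  then show "\<exists>cs. gsm_succ M w z cs \<and> k_visiting (card (states M)) cs"
    using cs(1) by (auto simp: k_visiting_def)
qed

text \<open>Whatever the parameters are, the output has at most one node per copy and input node.
  Applied to \<open>ed w\<close>, with \<open>length w + 1\<close> nodes, this bounds the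
  \<open>length z + 1\<close> nodes of \<open>ed z\<close>.\<close>

lemma NMSO_ed_bounded:
  assumes "m \<in> NMSO_ed" shows "\<exists>B. \<forall>(w, z) \<in> m. length z \<le> B w"
proof -
  from assms obtain T :: "(unit, 'a, unit, 'b) mso_trans" where T: "mso_trans_wf T"
    and m: "\<And>(g :: (nat, unit, 'a) graph) w z. graph_wf g \<Longrightarrow> (w, z) \<in> m \<Longrightarrow> graph_iso g (ed w) \<Longrightarrow>
      \<exists>h \<in> mso_out T g. graph_iso h (ed z)"
    unfolding NMSO_ed_def by blast
  have "length z \<le> Suc (length w) * card (copies T)" if wz: "(w, z) \<in> m" for w z
  proof -
    have "graph_wf (ed w)" by (auto simp: graph_wf_def ed_def)
    moreover have "graph_iso (ed w) (ed w)" by (auto simp: graph_iso_def intro!: exI[of _ id])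
    ultimately obtain h where h: "h \<in> mso_out T (ed w)" "graph_iso h (ed z)"
      using m[OF _ wz] by blast
    then have "verts h \<subseteq> {0..length w} \<times> copies T"
      by (auto simp: mso_out_def out_graph_def Let_def ed_def)
    moreover have "finite (copies T)" using T by (simp add: mso_trans_wf_def)
    ultimately have "card (verts h) \<le> Suc (length w) * card (copies T)"
      using card_mono[of "{0..length w} \<times> copies T" "verts h"] by (simp add: card_cartesian_product)
    moreover have "card (verts h) = Suc (length z)"
      using h(2) by (auto simp: graph_iso_def ed_def dest!: bij_betw_same_card)
    ultimately show ?thesis by simp
  qed
  then show ?thesis by (intro exI[of _ "\<lambda>w. Suc (length w) * card (copies T)"]) auto
qed

section \<open>Microconfigurations\<close>

text \<open>A flag \<open>True\<close> places the head beyond the last node, on the right endmarker;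
  stepping onto or off it changes the flag and keeps the node. The last branch is the move by -1.
  That a flagged node is the last one is checked in \<open>step\<close>.\<close>

definition move :: "('n, 'v, 'e) graph \<Rightarrow> bool \<Rightarrow> int \<Rightarrow> bool \<Rightarrow> 'n \<Rightarrow> 'n \<Rightarrow> bool" where
  "move g b e b' u v \<longleftrightarrow>
    (if e = 0 then b = b' \<and> u = v
     else if e = 1 then \<not> b \<and> (if b' then u = v else \<exists>\<gamma>. (u, \<gamma>, v) \<in> edges g)
     else \<not> b' \<and> (if b then u = v else \<exists>\<gamma>. (v, \<gamma>, u) \<in> edges g))"

definition move_fm :: "bool \<Rightarrow> int \<Rightarrow> bool \<Rightarrow> nat \<Rightarrow> nat \<Rightarrow> ('v, 'e::finite) mso" where
  "move_fm b e b' x y =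
    (if e = 0 then (if b = b' then Eq x y else Neg TT)
     else if e = 1 then (if b then Neg TT else if b' then Eq x y else Disjs UNIV (\<lambda>\<gamma>. Edge \<gamma> x y))
     else (if b' then Neg TT else if b then Eq x y else Disjs UNIV (\<lambda>\<gamma>. Edge \<gamma> y x)))"

lemma sat_move_fm [simp]: "sat g \<nu> S (move_fm b e b' x y) \<longleftrightarrow> move g b e b' (\<nu> x) (\<nu> y)"
  by (simp add: move_fm_def move_def)

lemma fv1_move_fm: "fv1 (move_fm b e b' x y) \<subseteq> {x, y}"
  by (auto simp: move_fm_def)

text \<open>Position \<open>i > 0\<close> within the word carries its letter \<open>i - 1\<close>,
  which labels the edge entering node \<open>i\<close>; node 0 represents the left
  endmarker.\<close>

definition read :: "('n, 'v, 'a) graph \<Rightarrow> 'a tsym \<Rightarrow> bool \<Rightarrow> 'n \<Rightarrow> bool" where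
  "read g \<sigma> b u \<longleftrightarrow> (case \<sigma> of LEnd \<Rightarrow> \<not> b \<and> first g u
     | Sym a \<Rightarrow> \<not> b \<and> (\<exists>v \<in> verts g. (v, a, u) \<in> edges g) | REnd \<Rightarrow> b)"

definition read_fm :: "'a tsym \<Rightarrow> bool \<Rightarrow> nat \<Rightarrow> ('v, 'a::finite) mso" where
  "read_fm \<sigma> b x = (case \<sigma> of LEnd \<Rightarrow> if b then Neg TT else first_fm x
     | Sym a \<Rightarrow> if b then Neg TT else Ex1 (Suc x) (Edge a (Suc x) x) | REnd \<Rightarrow> if b then TT else Neg TT)"

lemma sat_read_fm [simp]: "sat g \<nu> S (read_fm \<sigma> b x) \<longleftrightarrow> read g \<sigma> b (\<nu> x)"
  by (simp add: read_fm_def read_def split: tsym.split)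

lemma fv1_read_fm: "fv1 (read_fm \<sigma> b x) \<subseteq> {x}"
  by (auto simp: read_fm_def split: tsym.split)

text \<open>The tape \<open>\<turnstile>w\<stileturn>\<close> has one position more than \<open>ed w\<close> has nodes: the pair of the flag
  \<open>False\<close> and node \<open>i\<close> stands for position \<open>i\<close>, and the flag \<open>True\<close>, used with the last node
  only, marks the position of the right endmarker.\<close>

definition pos :: "'a list \<Rightarrow> bool \<Rightarrow> nat \<Rightarrow> nat" where
  "pos w b i = (if b then Suc (length w) else i)"

lemma ed_iso_read:
  assumes f: "ed_iso g w f" and u: "u \<in> verts g"
  shows "read g \<sigma> b u \<longleftrightarrow> tape w (pos w b (f u)) = \<sigma>"
proof (cases \<sigma>)
  case (Sym a)
  show ?thesis
  proof (cases "f u")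
    case 0
    then show ?thesis using Sym u by (auto simp: read_def tape_def pos_def ed_iso_edge[OF f])
  next
    case (Suc i)
    then have i: "i < length w" using ed_iso_le[OF f u] by simp
    then obtain v where v: "v \<in> verts g" "f v = i" using ed_iso_vertex[OF f, of i] by auto
    have "(\<exists>v \<in> verts g. (v, a, u) \<in> edges g) \<longleftrightarrow> a = w ! i"
      using v u Suc i by (auto simp: ed_iso_edge[OF f])
    then show ?thesis using Sym Suc i by (auto simp: read_def tape_def pos_def)
  qed
qed (use ed_iso_le[OF f u] ed_iso_first[OF f u] in \<open>auto simp: read_def tape_def pos_def\<close>)

lemma ed_iso_move:
  assumes f: "ed_iso g w f" and uv: "u \<in> verts g" "v \<in> verts g"
    and b: "b \<Longrightarrow> f u = length w" "b' \<Longrightarrow> f v = length w" and e: "e \<in> {-1, 0, 1}"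
  shows "move g b e b' u v \<longleftrightarrow> int (pos w b' (f v)) = int (pos w b (f u)) + e"
proof -
  have le: "f u \<le> length w" "f v \<le> length w" using ed_iso_le[OF f] uv by auto
  have eq: "u = v \<longleftrightarrow> f u = f v" using ed_iso_eq_iff[OF f uv] by simp
  have edge: "(\<exists>\<gamma>. (u, \<gamma>, v) \<in> edges g) \<longleftrightarrow> f v = Suc (f u)" "(\<exists>\<gamma>. (v, \<gamma>, u) \<in> edges g) \<longleftrightarrow> f u = Suc (f v)"
    using le uv by (auto simp: ed_iso_edge[OF f])
  show ?thesis
    using e b le unfolding move_def edge eq pos_def by (cases b; cases b') auto
qed

type_synonym mconf = "(nat \<times> nat) \<times> nat"

text \<open>A microconfiguration \<open>(d, j)\<close> has already written \<open>j\<close> letters of the output of the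
  instruction that is being executed in configuration \<open>d\<close>.\<close>

fun micro_exec :: "'a list \<Rightarrow> nat \<times> 'b list \<times> int \<Rightarrow> mconf \<Rightarrow> 'b option \<Rightarrow> mconf \<Rightarrow> bool" where
  "micro_exec w (q, \<alpha>, e) (d, j) (Some b) (d', j') \<longleftrightarrow> j < length \<alpha> \<and> b = \<alpha> ! j \<and> d' = d \<and> j' = Suc j"
| "micro_exec w (q, \<alpha>, e) (d, j) None (d', j') \<longleftrightarrow> j = length \<alpha> \<and> j' = 0 \<and> exec w (q, \<alpha>, e) d \<alpha> d'"

text \<open>\<open>A\<close> abstracts from the guess: it tells which actions may be taken in a
  configuration, and is later instantiated with the instructions selected by the parameters.\<close>

definition micro_rel :: "'a list \<Rightarrow> (nat \<times> nat \<Rightarrow> nat \<times> 'b list \<times> int \<Rightarrow> bool) \<Rightarrow> mconf \<Rightarrow> 'b option \<Rightarrow> mconf \<Rightarrow> bool" where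
  "micro_rel w A x l y \<longleftrightarrow> (\<exists>a. A (fst x) a \<and> micro_exec w a x l y)"

definition macro_rel :: "'a list \<Rightarrow> (nat \<times> nat \<Rightarrow> nat \<times> 'b list \<times> int \<Rightarrow> bool) \<Rightarrow> nat \<times> nat \<Rightarrow> 'b list \<Rightarrow> nat \<times> nat \<Rightarrow> bool" where
  "macro_rel w A d \<alpha> d' \<longleftrightarrow> (\<exists>a. A d a \<and> exec w a d \<alpha> d')"

lemma micro_exec_det:
  assumes "micro_exec w a x l y" "micro_exec w a x l' y'" shows "l = l' \<and> y = y'"
  using assms by (cases a; cases x; cases l; cases l'; cases y; cases y')
    (auto simp: exec_def prod_eq_iff)

lemma macro_imp_micro:
  assumes "lpath (macro_rel w A) es \<alpha>s"
  shows "\<exists>xs ls. lpath (micro_rel w A) xs ls \<and> hd xs = (hd es, 0) \<and> last xs = (last es, 0) \<and>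
    vis ls = concat \<alpha>s"
  using assms
proof (induction \<alpha>s arbitrary: es)
  case Nil
  then obtain d where d: "es = [d]" by auto
  have "lpath (micro_rel w A) [(d, 0)] []" by simp
  then show ?case using d by (intro exI[of _ "[(d, 0)]"] exI[of _ "[]"]) simp
next
  case (Cons \<alpha> \<alpha>s)
  from Cons.prems obtain d es' where es: "es = d # es'" "macro_rel w A d \<alpha> (hd es')"
    "lpath (macro_rel w A) es' \<alpha>s" by (rule lpath_ConsE)
  from Cons.IH[OF es(3)] obtain xs ls where xs: "lpath (micro_rel w A) xs ls" "hd xs = (hd es', 0)"
    "last xs = (last es', 0)" "vis ls = concat \<alpha>s" by blast
  from es(2) obtain q e where a: "A d (q, \<alpha>, e)" "exec w (q, \<alpha>, e) d \<alpha> (hd es')"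
    by (auto simp: macro_rel_def exec_def)
  \<comment> \<open>The micro steps of the first instruction are prepended backwards: the silent
    move, then its letters from the last to the first.\<close>
  have "\<exists>ys ls. lpath (micro_rel w A) ys ls \<and> hd ys = (d, j) \<and> last ys = (last es', 0) \<and>
      vis ls = drop j \<alpha> @ concat \<alpha>s" if "j \<le> length \<alpha>" for j
    using that
  proof (induction rule: inc_induct)
    case base
    have "micro_rel w A (d, length \<alpha>) None (hd xs)"
      unfolding micro_rel_def using a xs(2) by (intro exI[of _ "(q, \<alpha>, e)"]) simp
    then show ?case using xs lpath_not_Nil[OF xs(1)]
      by (intro exI[of _ "(d, length \<alpha>) # xs"] exI[of _ "None # ls"]) (simp add: lpath_Cons)
  next
    case (step j)
    then obtain ys ls where ys: "lpath (micro_rel w A) ys ls" "hd ys = (d, Suc j)"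
      "last ys = (last es', 0)" "vis ls = drop (Suc j) \<alpha> @ concat \<alpha>s" by blast
    have "micro_rel w A (d, j) (Some (\<alpha> ! j)) (hd ys)"
      unfolding micro_rel_def using a ys(2) step.hyps by (intro exI[of _ "(q, \<alpha>, e)"]) simp
    then show ?case using ys lpath_not_Nil[OF ys(1)] step.hyps
      by (intro exI[of _ "(d, j) # ys"] exI[of _ "Some (\<alpha> ! j) # ls"])
        (simp add: lpath_Cons Cons_nth_drop_Suc[symmetric])
  qed
  from this[of 0] show ?case using es lpath_not_Nil[OF es(3)] by simp
qed

text \<open>Single-valuedness of \<open>A\<close> prevents a micro run from switching to another
  action halfway through the output of an instruction.\<close>

lemma micro_imp_macro:
  assumes A: "\<And>d a a'. A d a \<Longrightarrow> A d a' \<Longrightarrow> a = a'"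
    and "lpath (micro_rel w A) xs ls" "hd xs = (d, 0)" "last xs = (d', 0)"
  shows "\<exists>es \<alpha>s. lpath (macro_rel w A) es \<alpha>s \<and> hd es = d \<and> last es = d' \<and> vis ls = concat \<alpha>s"
proof -
  \<comment> \<open>Invariant for the rest of a micro run from \<open>(d, j)\<close>: for
    \<open>j > 0\<close> an action is pending at \<open>d\<close> with
    \<open>drop j \<alpha>\<close> still to be written; for \<open>j = 0\<close> nothing is pending,
    which also covers the last configuration, where no action need exist.\<close>
  define C where "C d j ls \<longleftrightarrow>
    (j = 0 \<and> (\<exists>es \<alpha>s. lpath (macro_rel w A) es \<alpha>s \<and> hd es = d \<and> last es = d' \<and> vis ls = concat \<alpha>s)) \<or>
    (j > 0 \<and> (\<exists>es \<alpha>s q \<alpha> e. lpath (macro_rel w A) es \<alpha>s \<and> last es = d' \<and> A d (q, \<alpha>, e) \<and>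
      exec w (q, \<alpha>, e) d \<alpha> (hd es) \<and> vis ls = drop j \<alpha> @ concat \<alpha>s))" for d j ls
  have CI: "C d j ls" if "lpath (macro_rel w A) es \<alpha>s" "last es = d'" "A d (q, \<alpha>, e)"
      "exec w (q, \<alpha>, e) d \<alpha> (hd es)" "vis ls = drop j \<alpha> @ concat \<alpha>s" for d j ls es \<alpha>s q \<alpha> e
  proof (cases j)
    case 0
    have "macro_rel w A d \<alpha> (hd es)" using that by (auto simp: macro_rel_def)
    then have "lpath (macro_rel w A) (d # es) (\<alpha> # \<alpha>s)" "hd (d # es) = d" "last (d # es) = d'"
      "vis ls = concat (\<alpha> # \<alpha>s)"
      using that 0 lpath_not_Nil[OF that(1)] by (simp_all add: lpath_Cons)
    then show ?thesis using 0 unfolding C_def by blast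
  next
    case (Suc j')
    then show ?thesis using that unfolding C_def by blast
  qed
  have "C d j ls" if "lpath (micro_rel w A) xs ls" "hd xs = (d, j)" "last xs = (d', 0)" for xs ls d j
    using that
  proof (induction ls arbitrary: xs d j)
    case Nil
    then have "d = d'" "j = 0" by auto
    then show ?case unfolding C_def
      by (intro disjI1 conjI exI[of _ "[d']"] exI[of _ "[]"]) simp_all
  next
    case (Cons l ls)
    from Cons.prems(1) obtain x xs' where xs: "xs = x # xs'" "micro_rel w A x l (hd xs')"
      "lpath (micro_rel w A) xs' ls" by (rule lpath_ConsE)
    have x: "x = (d, j)" using xs Cons.prems by simp
    have last: "last xs' = (d', 0)" using xs Cons.prems lpath_not_Nil[OF xs(3)] by simp
    obtain d1 j1 where x1: "hd xs' = (d1, j1)" by fastforce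
    have IH: "C d1 j1 ls" using Cons.IH[OF xs(3) x1 last] .
    from xs(2) obtain q \<alpha> e where a: "A d (q, \<alpha>, e)" "micro_exec w (q, \<alpha>, e) (d, j) l (d1, j1)"
      unfolding micro_rel_def x x1 by auto
    show ?case
    proof (cases l)
      case None
      then have j: "j = length \<alpha>" "j1 = 0" "exec w (q, \<alpha>, e) d \<alpha> d1" using a by auto
      then obtain es \<alpha>s where "lpath (macro_rel w A) es \<alpha>s" "hd es = d1" "last es = d'"
        "vis ls = concat \<alpha>s" using IH unfolding C_def by blast
      then show ?thesis using j a None by (intro CI[of es \<alpha>s d q \<alpha> e]) auto
    next
      case (Some b)
      then have j: "j < length \<alpha>" "b = \<alpha> ! j" "d1 = d" "j1 = Suc j" using a by auto
      then obtain es \<alpha>s q' \<alpha>' e' where es: "lpath (macro_rel w A) es \<alpha>s" "last es = d'"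
        "A d (q', \<alpha>', e')" "exec w (q', \<alpha>', e') d \<alpha>' (hd es)" "vis ls = drop (Suc j) \<alpha>' @ concat \<alpha>s"
        using IH unfolding C_def by blast
      then have "(q', \<alpha>', e') = (q, \<alpha>, e)" using A a by blast
      then show ?thesis using es j Some
        by (intro CI[of es \<alpha>s d q \<alpha> e]) (auto simp: Cons_nth_drop_Suc)
    qed
  qed
  from this[OF assms(2-4)] show ?thesis unfolding C_def by simp
qed

section \<open>The run graph of a 2gsm\<close>

type_synonym copy = "bool \<times> nat \<times> nat"

fun node_exec :: "('n, 'v, 'e) graph \<Rightarrow> nat \<times> 'b list \<times> int \<Rightarrow> 'n \<times> copy \<Rightarrow> 'b option \<Rightarrow> 'n \<times> copy \<Rightarrow> bool" where
  "node_exec g (q, \<alpha>, e) (u, b, p, j) (Some \<gamma>) (v, b', p', j') \<longleftrightarrow>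
     j < length \<alpha> \<and> \<gamma> = \<alpha> ! j \<and> b' = b \<and> p' = p \<and> j' = Suc j \<and> u = v"
| "node_exec g (q, \<alpha>, e) (u, b, p, j) None (v, b', p', j') \<longleftrightarrow>
     j = length \<alpha> \<and> p' = q \<and> j' = 0 \<and> move g b e b' u v"

fun exec_fm :: "nat \<times> 'b list \<times> int \<Rightarrow> copy \<Rightarrow> 'b option \<Rightarrow> copy \<Rightarrow> nat \<Rightarrow> nat \<Rightarrow> ('v, 'e::finite) mso" where
  "exec_fm (q, \<alpha>, e) (b, p, j) (Some \<gamma>) (b', p', j') x y =
     (if j < length \<alpha> \<and> \<gamma> = \<alpha> ! j \<and> b' = b \<and> p' = p \<and> j' = Suc j then Eq x y else Neg TT)"
| "exec_fm (q, \<alpha>, e) (b, p, j) None (b', p', j') x y =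
     (if j = length \<alpha> \<and> p' = q \<and> j' = 0 then move_fm b e b' x y else Neg TT)"

lemma sat_exec_fm [simp]:
  "sat g \<nu> S (exec_fm a c l c' x y) \<longleftrightarrow> node_exec g a (\<nu> x, c) l (\<nu> y, c')"
  by (cases a; cases c; cases l; cases c') auto

lemma fv1_exec_fm: "fv1 (exec_fm a c l c' x y) \<subseteq> {x, y}"
  by (cases a; cases c; cases l; cases c') (simp_all add: fv1_move_fm)

locale wf_gsm =
  fixes M :: "('a::finite, 'b::finite) gsm"
  assumes wf: "gsm_wf M"
begin

text \<open>Indexes the parameters: the set for \<open>(t, b)\<close> holds the nodes at which
  \<open>t\<close> is guessed for the state \<open>fst t\<close>. The flag separates the last node
  from the right endmarker.\<close>

definition guesses :: "(('a, 'b) instr \<times> bool) set" where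
  "guesses = delta M \<times> UNIV"

text \<open>The last component counts the letters already written by the current instruction, hence
  the bound \<open>max_out M\<close>.\<close>

definition Cs :: "copy set" where
  "Cs = UNIV \<times> states M \<times> {..max_out M}"

text \<open>Exclusiveness is built in: if two instructions for the same state are guessed at one
  place, none is selected. Thus every assignment gives a deterministic relation.\<close>

definition selected :: "(nat \<Rightarrow> 'n set) \<Rightarrow> bool \<Rightarrow> 'n \<Rightarrow> ('a, 'b) instr \<Rightarrow> bool" where
  "selected S b u t \<longleftrightarrow> u \<in> S (enc guesses (t, b)) \<and>
     (\<forall>t' \<in> {t' \<in> delta M. fst t' = fst t \<and> t' \<noteq> t}. u \<notin> S (enc guesses (t', b)))"

definition selected_fm :: "bool \<Rightarrow> ('a, 'b) instr \<Rightarrow> nat \<Rightarrow> (unit, 'a) mso" where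
  "selected_fm b t x = Conj (Mem x (2 * enc guesses (t, b)))
     (Conjs {t' \<in> delta M. fst t' = fst t \<and> t' \<noteq> t} (\<lambda>t'. Neg (Mem x (2 * enc guesses (t', b)))))"

definition step_fm :: "copy \<Rightarrow> 'b option \<Rightarrow> copy \<Rightarrow> nat \<Rightarrow> nat \<Rightarrow> (unit, 'a) mso" where
  "step_fm c l c' x y =
     Conj (if fst c then final_fm x else TT) (Conj (if fst c' then final_fm y else TT)
       (Disjs {t \<in> delta M. fst t = fst (snd c)} (\<lambda>t. Conj (selected_fm (fst c) t x)
         (Disj (Conj (read_fm (sym t) (fst c) x) (exec_fm (act t True) c l c' x y))
           (Conj (Neg (read_fm (sym t) (fst c) x)) (exec_fm (act t False) c l c' x y))))))"

text \<open>The two conditions with \<open>final\<close> confine the endmarker flag to the last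
  node.\<close>

definition step :: "(nat, unit, 'a) graph \<Rightarrow> (nat \<Rightarrow> nat set) \<Rightarrow> nat \<times> copy \<Rightarrow> 'b option \<Rightarrow> nat \<times> copy \<Rightarrow> bool" where
  "step g S d l d' \<longleftrightarrow> (fst (snd d) \<longrightarrow> final g (fst d)) \<and> (fst (snd d') \<longrightarrow> final g (fst d')) \<and>
     (\<exists>t \<in> delta M. fst t = fst (snd (snd d)) \<and> selected S (fst (snd d)) (fst d) t \<and>
        node_exec g (act t (read g (sym t) (fst (snd d)) (fst d))) d l d')"

lemma finite_delta: "finite (delta M)"
  using wf by (simp add: gsm_wf_def)

lemma finite_guesses: "finite guesses"
  using finite_delta by (simp add: guesses_def)

lemma finite_Cs: "finite Cs"
  using wf by (simp add: Cs_def gsm_wf_def)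

lemma sat_selected_fm: "sat g \<nu> S (selected_fm b t x) \<longleftrightarrow> selected (\<lambda>n. S (2 * n)) b (\<nu> x) t"
  by (simp add: selected_fm_def selected_def finite_delta)

lemma fv1_selected_fm: "fv1 (selected_fm b t x) \<subseteq> {x}"
  by (auto simp: selected_fm_def finite_delta)

lemma sat_step_fm:
  "sat g \<nu> S (step_fm c l c' x y) \<longleftrightarrow> step g (\<lambda>n. S (2 * n)) (\<nu> x, c) l (\<nu> y, c')"
proof -
  have if_act: "(r \<and> node_exec g (act t True) d l d' \<or> \<not> r \<and> node_exec g (act t False) d l d') \<longleftrightarrow>
      node_exec g (act t r) d l d'" for r and t :: "('a, 'b) instr" and d d' :: "nat \<times> copy"
    by (cases r) auto
  have if_final: "sat g \<nu> S (if b then final_fm x else TT) \<longleftrightarrow> (b \<longrightarrow> final g (\<nu> x))" for b x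
    by simp
  have fin: "finite {t \<in> delta M. P t}" for P using finite_delta by simp
  show ?thesis
    unfolding step_fm_def step_def sat.simps sat_Disjs[OF fin] sat_Disj sat_selected_fm sat_read_fm
      sat_exec_fm if_act if_final fst_conv snd_conv by blast
qed

lemma fv1_step_fm: "fv1 (step_fm c l c' x y) \<subseteq> {x, y}"
proof -
  have 1: "fv1 (selected_fm b t x) \<subseteq> {x, y}" for b t using fv1_selected_fm by blast
  have 2: "fv1 (read_fm \<sigma> b x) \<subseteq> {x, y}" for \<sigma> b using fv1_read_fm by blast
  have fin: "finite {t \<in> delta M. P t}" for P using finite_delta by simp
  show ?thesis
    unfolding step_fm_def fv1.simps fv1_Disjs[OF fin] fv1_Disj
    by (intro Un_least UN_least 1 2 fv1_exec_fm) simp_all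
qed

sublocale rg: definable Cs UNIV step_fm step
  by unfold_locales (simp_all add: finite_Cs sat_step_fm fv1_step_fm)

section \<open>The run graph over a fixed string graph\<close>

context
  fixes g :: "(nat, unit, 'a) graph" and w :: "'a list" and f :: "nat \<Rightarrow> nat"
  assumes iso: "ed_iso g w f"
begin

definition valid :: "nat \<Rightarrow> bool \<Rightarrow> bool" where
  "valid u b \<longleftrightarrow> u \<in> verts g \<and> (b \<longrightarrow> f u = length w)"

definition mconf_of :: "nat \<times> copy \<Rightarrow> mconf" where
  "mconf_of = (\<lambda>(u, b, p, j). ((p, pos w b (f u)), j))"

text \<open>The minimum sends the right endmarker, at position \<open>length w + 1\<close>, to the
  last node; \<open>of_mconf\<close> adds the flag.\<close>

definition node_of :: "nat \<Rightarrow> nat" where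
  "node_of i = (SOME u. u \<in> verts g \<and> f u = min i (length w))"

definition of_mconf :: "mconf \<Rightarrow> nat \<times> copy" where
  "of_mconf = (\<lambda>((p, i), j). (node_of i, length w < i, p, j))"

definition chosen :: "(nat \<Rightarrow> nat set) \<Rightarrow> nat \<times> nat \<Rightarrow> nat \<times> 'b list \<times> int \<Rightarrow> bool" where
  "chosen S d a \<longleftrightarrow> (\<exists>u b. \<exists>t \<in> delta M. valid u b \<and> snd d = pos w b (f u) \<and> fst t = fst d \<and>
     selected S b u t \<and> a = act t (tape w (snd d) = sym t))"

lemma pos_inject:
  "valid u b \<Longrightarrow> valid v b' \<Longrightarrow> pos w b (f u) = pos w b' (f v) \<longleftrightarrow> u = v \<and> b = b'"
  using ed_iso_le[OF iso] ed_iso_eq_iff[OF iso, of u v]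
  by (cases b; cases b') (fastforce simp: valid_def pos_def)+

lemma pos_le: "valid u b \<Longrightarrow> pos w b (f u) \<le> Suc (length w)"
  using ed_iso_le[OF iso] by (auto simp: valid_def pos_def le_SucI)

lemma mconf_of_inject:
  assumes "valid (fst d) (fst (snd d))" "valid (fst d') (fst (snd d'))" "mconf_of d = mconf_of d'"
  shows "d = d'"
  using assms pos_inject by (cases d; cases d') (auto simp: mconf_of_def)

lemma node_of: "node_of i \<in> verts g" "f (node_of i) = min i (length w)"
proof -
  have "\<exists>u. u \<in> verts g \<and> f u = min i (length w)"
    using ed_iso_vertex[OF iso, of "min i (length w)"] by auto
  from someI_ex[OF this] show "node_of i \<in> verts g" "f (node_of i) = min i (length w)"
    by (simp_all add: node_of_def)
qed

lemma valid_of_mconf: "valid (fst (of_mconf x)) (fst (snd (of_mconf x)))"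
  using node_of by (auto simp: valid_def of_mconf_def split: prod.split)

lemma mconf_of_of_mconf: "snd (fst x) \<le> Suc (length w) \<Longrightarrow> mconf_of (of_mconf x) = x"
  using node_of by (auto simp: mconf_of_def of_mconf_def pos_def split: prod.split)

lemma chosen_unique:
  assumes "chosen S d a" "chosen S d a'" shows "a = a'"
proof -
  obtain u b t where t: "t \<in> delta M" "valid u b" "snd d = pos w b (f u)" "fst t = fst d"
     "selected S b u t" "a = act t (tape w (snd d) = sym t)" using assms(1) by (auto simp: chosen_def)
  obtain u' b' t' where t': "t' \<in> delta M" "valid u' b'" "snd d = pos w b' (f u')" "fst t' = fst d"
     "selected S b' u' t'" "a' = act t' (tape w (snd d) = sym t')" using assms(2) by (auto simp: chosen_def)
  have "u = u'" "b = b'" using t t' pos_inject by auto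
  moreover have "fst t' = fst t" using t t' by simp
  ultimately have "t = t'" using t t' unfolding selected_def by blast
  then show ?thesis using t t' by simp
qed

lemma node_exec_iff:
  assumes "valid (fst d) (fst (snd d))" "valid (fst d') (fst (snd d'))"
    and "t \<in> delta M" "a = act t s"
  shows "node_exec g a d l d' \<longleftrightarrow> micro_exec w a (mconf_of d) l (mconf_of d')"
proof -
  obtain u b p j where d: "d = (u, b, p, j)" by (cases d) auto
  obtain v b' p' j' where d': "d' = (v, b', p', j')" by (cases d') auto
  obtain q \<alpha> e where a: "a = (q, \<alpha>, e)" by (cases a) auto
  have v: "valid u b" "valid v b'" using assms(1,2) d d' by auto
  have e: "e \<in> {-1, 0, 1}" using wf_delta(4)[OF wf assms(3)] assms(4) a by metis
  have move: "move g b e b' u v \<longleftrightarrow> int (pos w b' (f v)) = int (pos w b (f u)) + e"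
    by (rule ed_iso_move[OF iso _ _ _ _ e]) (use v in \<open>auto simp: valid_def\<close>)
  show ?thesis
  proof (cases l)
    case None
    then show ?thesis using pos_le[OF v(2)] by (auto simp: a d d' mconf_of_def exec_def move)
  next
    case (Some \<gamma>)
    then show ?thesis using pos_inject[OF v(2,1)] by (auto simp: a d d' mconf_of_def)
  qed
qed

text \<open>On a string graph, the run graph is the micro relation of the machine under the selected
  instructions, transported along \<open>mconf_of\<close>. Determinism, soundness and completeness
  all pass through this bridge.\<close>

lemma rel_iff:
  "rg.rel g S d l d' \<longleftrightarrow> valid (fst d) (fst (snd d)) \<and> valid (fst d') (fst (snd d')) \<and>
    snd d \<in> Cs \<and> snd d' \<in> Cs \<and> micro_rel w (chosen S) (mconf_of d) l (mconf_of d')"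
  (is "_ \<longleftrightarrow> ?valid d \<and> ?valid d' \<and> _")
proof -
  have valid: "fst d \<in> verts g \<and> (fst (snd d) \<longrightarrow> final g (fst d)) \<longleftrightarrow> ?valid d" for d :: "nat \<times> copy"
    using ed_iso_final[OF iso] by (auto simp: valid_def)
  have "(\<exists>t \<in> delta M. fst t = fst (snd (snd d)) \<and> selected S (fst (snd d)) (fst d) t \<and>
        node_exec g (act t (read g (sym t) (fst (snd d)) (fst d))) d l d') \<longleftrightarrow>
      micro_rel w (chosen S) (mconf_of d) l (mconf_of d')" if v: "?valid d" "?valid d'"
  proof -
    have d: "fst (mconf_of d) = (fst (snd (snd d)), pos w (fst (snd d)) (f (fst d)))"
      by (simp add: mconf_of_def split_beta)
    have ch: "chosen S (fst (mconf_of d)) a \<longleftrightarrow> (\<exists>t \<in> delta M. fst t = fst (snd (snd d)) \<and>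
        selected S (fst (snd d)) (fst d) t \<and> a = act t (read g (sym t) (fst (snd d)) (fst d)))" for a
    proof -
      have "read g \<sigma> (fst (snd d)) (fst d) \<longleftrightarrow> tape w (pos w (fst (snd d)) (f (fst d))) = \<sigma>" for \<sigma>
        using v ed_iso_read[OF iso] by (simp add: valid_def)
      then show ?thesis unfolding chosen_def d using v pos_inject by (simp; blast)
    qed
    show ?thesis
      unfolding micro_rel_def ch using node_exec_iff[OF v _ refl] by blast
  qed
  then show ?thesis
    unfolding rg.rel_def step_def using valid[of d] valid[of d'] by (auto simp: mem_Times_iff)
qed

lemma det_rel: "det (rg.rel g S)"
  unfolding det_def
proof (intro allI impI)
  fix d l e l' e' assume "rg.rel g S d l e" "rg.rel g S d l' e'"
  then have r: "micro_rel w (chosen S) (mconf_of d) l (mconf_of e)"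
    "micro_rel w (chosen S) (mconf_of d) l' (mconf_of e')"
    and v: "valid (fst e) (fst (snd e))" "valid (fst e') (fst (snd e'))" by (auto simp: rel_iff)
  from r have "l = l' \<and> mconf_of e = mconf_of e'"
    unfolding micro_rel_def using chosen_unique micro_exec_det by metis
  then show "l = l' \<and> e = e'" using mconf_of_inject[OF v] by simp
qed

text \<open>Every selected action belongs to an instruction of \<open>M\<close>, so whatever the
  parameters are, a run of the graph is a computation of \<open>M\<close>.\<close>

lemma sound:
  assumes u: "u \<in> verts g" "f u = 0"
    and ds: "lpath (rg.rel g S) ds ls" "hd ds = (u, False, q_in M, 0)"
      "snd (last ds) \<in> UNIV \<times> {q_f M} \<times> {0}"
  shows "(w, vis ls) \<in> gsm_rel M"
proof -
  have ne: "ds \<noteq> []" using ds(1) by (rule lpath_not_Nil)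
  obtain v b where last: "last ds = (v, b, q_f M, 0)" using ds(3) by (cases "last ds") auto
  have "lpath (micro_rel w (chosen S)) (map mconf_of ds) ls"
    using ds(1) by (auto simp: lpath_def rel_iff)
  moreover have "hd (map mconf_of ds) = ((q_in M, 0), 0)"
    using ne ds(2) u by (simp add: hd_map mconf_of_def pos_def)
  moreover have "last (map mconf_of ds) = ((q_f M, pos w b (f v)), 0)"
    using ne last by (simp add: last_map mconf_of_def)
  moreover have "a = a'" if "chosen S d a" "chosen S d a'" for d a a'
    using that by (rule chosen_unique)
  ultimately obtain es \<alpha>s where es: "lpath (macro_rel w (chosen S)) es \<alpha>s" "hd es = (q_in M, 0)"
    "last es = (q_f M, pos w b (f v))" "vis ls = concat \<alpha>s"
    using micro_imp_macro[of "chosen S" w] by meson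
  have "macro_rel w (chosen S) d \<alpha> d' \<Longrightarrow> gstep M w d \<alpha> d'" for d \<alpha> d'
    by (auto simp: macro_rel_def chosen_def gstep_def)
  then have "accepts M w es \<alpha>s" using es by (auto simp: accepts_def lpath_def)
  then show ?thesis using es(4) by (auto simp: gsm_rel_iff)
qed

text \<open>A computation without repeated configurations executes only one instruction in each of
  them, and can therefore be stored in the parameters.\<close>

lemma complete:
  assumes acc: "accepts M w es \<alpha>s" and dist: "distinct es" and u: "u \<in> verts g" "f u = 0"
  shows "\<exists>S ds ls. (\<forall>n. S n \<subseteq> verts g) \<and> lpath (rg.rel g S) ds ls \<and> hd ds = (u, False, q_in M, 0) \<and>
    snd (last ds) \<in> UNIV \<times> {q_f M} \<times> {0} \<and> vis ls = concat \<alpha>s"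
proof -
  have path: "lpath (gstep M w) es \<alpha>s" and hd: "hd es = (q_in M, 0)" and last: "fst (last es) = q_f M"
    using acc by (auto simp: accepts_def)
  have len: "length es = Suc (length \<alpha>s)" using path by (simp add: lpath_def)
  have "\<exists>t. t \<in> delta M \<and> fst t = fst (es ! n) \<and>
      exec w (act t (tape w (snd (es ! n)) = sym t)) (es ! n) (\<alpha>s ! n) (es ! Suc n)"
    if "n < length \<alpha>s" for n
    using path that unfolding lpath_def gstep_def by blast
  then obtain t where t: "\<And>n. n < length \<alpha>s \<Longrightarrow> t n \<in> delta M \<and> fst (t n) = fst (es ! n) \<and>
      exec w (act (t n) (tape w (snd (es ! n)) = sym (t n))) (es ! n) (\<alpha>s ! n) (es ! Suc n)"
    by metis
  \<comment> \<open>The node of the \<open>n\<close>-th configuration goes into the set of the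
    instruction executed at time \<open>n\<close>; the state needs no index, being
    \<open>fst (t n)\<close>.\<close>
  define S where "S m = {u. \<exists>b n. valid u b \<and> n < length \<alpha>s \<and> m = enc guesses (t n, b) \<and>
    snd (es ! n) = pos w b (f u)}" for m
  have S_le: "S m \<subseteq> verts g" for m by (auto simp: S_def valid_def)
  have bound: "snd d \<le> Suc (length w)" "fst d \<in> states M" if "d \<in> set es" for d
    using accepts_bounds[OF wf acc that] by auto
  have chosen: "chosen S (es ! n) (act (t n) (tape w (snd (es ! n)) = sym (t n)))"
    if n: "n < length \<alpha>s" for n
  proof -
    let ?x = "of_mconf (es ! n, 0)"
    let ?u = "fst ?x" and ?b = "fst (snd ?x)"
    have "mconf_of ?x = (es ! n, 0)"
      by (rule mconf_of_of_mconf) (use bound[of "es ! n"] n len in simp)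
    moreover have "snd (fst (mconf_of ?x)) = pos w ?b (f ?u)"
      by (simp add: mconf_of_def split_beta)
    ultimately have pos: "snd (es ! n) = pos w ?b (f ?u)" by simp
    have v: "valid ?u ?b" by (rule valid_of_mconf)
    have "?u \<in> S (enc guesses (t n, ?b))" using v pos n by (auto simp: S_def)
    moreover have "?u \<notin> S (enc guesses (t', ?b))"
      if t': "t' \<in> delta M" "fst t' = fst (t n)" "t' \<noteq> t n" for t'
    proof
      assume "?u \<in> S (enc guesses (t', ?b))"
      then obtain b' m where m: "valid ?u b'" "m < length \<alpha>s" "enc guesses (t', ?b) = enc guesses (t m, b')"
        "snd (es ! m) = pos w b' (f ?u)" by (auto simp: S_def)
      then have eq: "t' = t m \<and> ?b = b'"
        using inj_on_enc[OF finite_guesses] t[OF m(2)] t'(1) by (auto simp: inj_on_def guesses_def)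
      \<comment> \<open>Instructions with the same source state guessed at the same place belong to
        the same configuration; distinctness then makes the times equal, so \<open>selected\<close>
        finds no rival.\<close>
      then have "es ! m = es ! n" using m(4) pos t[OF m(2)] t[OF n] t'(2) by (simp add: prod_eq_iff)
      then have "m = n" using dist m(2) n len by (simp add: nth_eq_iff_index_eq)
      then show False using eq t'(3) by simp
    qed
    ultimately have "selected S ?b ?u (t n)" by (auto simp: selected_def)
    then show ?thesis unfolding chosen_def using v pos t[OF n] by blast
  qed
  have "lpath (macro_rel w (chosen S)) es \<alpha>s"
    unfolding lpath_def macro_rel_def using len chosen t by blast
  then obtain xs ls where xs: "lpath (micro_rel w (chosen S)) xs ls" "hd xs = ((q_in M, 0), 0)"
    "last xs = (last es, 0)" "vis ls = concat \<alpha>s"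
    using macro_imp_micro hd by metis
  have ne: "xs \<noteq> []" using xs(1) by (rule lpath_not_Nil)
  have rel: "rg.rel g S (of_mconf x) l (of_mconf y)" if r: "micro_rel w (chosen S) x l y" for x l y
  proof -
    obtain d j d' j' where xy: "x = (d, j)" "y = (d', j')" by (cases x; cases y)
    from r obtain q \<alpha> e where a: "chosen S d (q, \<alpha>, e)" "micro_exec w (q, \<alpha>, e) (d, j) l (d', j')"
      by (auto simp: micro_rel_def xy)
    from a(1) obtain v b t where t: "t \<in> delta M" "valid v b" "snd d = pos w b (f v)" "fst t = fst d"
      "act t (tape w (snd d) = sym t) = (q, \<alpha>, e)" by (auto simp: chosen_def)
    have 1: "length \<alpha> \<le> max_out M" "fst d \<in> states M" "q \<in> states M"
      using max_out[OF wf t(1,5)] wf_delta[OF wf t(1,5)] t(4) by auto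
    have 2: "snd d \<le> Suc (length w)" using pos_le[OF t(2)] t(3) by simp
    have 3: "j \<le> max_out M" "j' \<le> max_out M" "fst d' \<in> states M" "snd d' \<le> Suc (length w)"
      using a(2) 1 2 by (cases l; auto simp: exec_def)+
    have "snd (of_mconf x) \<in> Cs" "snd (of_mconf y) \<in> Cs"
      using 1 3 by (auto simp: xy of_mconf_def Cs_def split_beta)
    moreover have "mconf_of (of_mconf x) = x" "mconf_of (of_mconf y) = y"
      using 2 3 by (auto simp: xy intro!: mconf_of_of_mconf)
    ultimately show ?thesis using r valid_of_mconf by (simp add: rel_iff)
  qed
  have "lpath (rg.rel g S) (map of_mconf xs) ls"
    using xs(1) rel by (auto simp: lpath_def)
  moreover have "node_of 0 = u" using node_of[of 0] u ed_iso_eq_iff[OF iso, of "node_of 0" u] by simp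
  then have "hd (map of_mconf xs) = (u, False, q_in M, 0)"
    using ne xs(2) by (simp add: hd_map of_mconf_def)
  moreover have "snd (last (map of_mconf xs)) \<in> UNIV \<times> {q_f M} \<times> {0}"
    using ne xs(3) last by (simp add: last_map of_mconf_def split_beta)
  ultimately show ?thesis
    using S_le xs(4) by (intro exI[of _ S] exI[of _ "map of_mconf xs"] exI[of _ ls] conjI) simp_all
qed

end

text \<open>End copies have state \<open>q_f\<close> and counter 0. They are dead ends because no
  instruction starts in \<open>q_f\<close>.\<close>

sublocale rg: run_graph Cs step_fm step "(False, q_in M, 0)" "UNIV \<times> {q_f M} \<times> {0}"
proof unfold_locales
  show "(False, q_in M, 0) \<in> Cs" "UNIV \<times> {q_f M} \<times> {0} \<subseteq> Cs"
    using wf by (auto simp: Cs_def gsm_wf_def)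
  show "det (rg.rel g S)" if "ed_iso g w f" for g w f S
    using det_rel[OF that] .
  show "\<not> rg.rel g S (u, c) l e" if "c \<in> UNIV \<times> {q_f M} \<times> {0}" for g S u c l e
  proof
    assume "rg.rel g S (u, c) l e"
    then obtain t where t: "t \<in> delta M" "fst t = fst (snd c)"
      unfolding rg.rel_def step_def fst_conv snd_conv by blast
    obtain q \<alpha> e where "act t True = (q, \<alpha>, e)" by (cases "act t True")
    from wf_delta(2)[OF wf t(1) this] show False using t(2) that by auto
  qed
qed

text \<open>The bound enters through completeness: it provides the repetition-free computation that
  one guess per configuration can encode.\<close>

lemma bounded_NMSO_ed:
  assumes "\<And>w z. (w, z) \<in> gsm_rel M \<Longrightarrow> length z \<le> B w"
  shows "gsm_rel M \<in> NMSO_ed"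
proof (rule rg.NMSO_edI)
  show "(w, vis ls) \<in> gsm_rel M"
    if "ed_iso g w f" "u \<in> verts g" "f u = 0" "lpath (rg.rel g S) ds ls"
      "hd ds = (u, False, q_in M, 0)" "snd (last ds) \<in> UNIV \<times> {q_f M} \<times> {0}" for g w f S u ds ls
    using sound[OF that] .
  show "\<exists>S ds ls. (\<forall>n. S n \<subseteq> verts g) \<and> lpath (rg.rel g S) ds ls \<and> hd ds = (u, False, q_in M, 0) \<and>
      snd (last ds) \<in> UNIV \<times> {q_f M} \<times> {0} \<and> vis ls = z"
    if "(w, z) \<in> gsm_rel M" "ed_iso g w f" "u \<in> verts g" "f u = 0" for g w f z u
    using bounded_accepts_distinct[OF assms that(1)] complete[OF that(2) _ _ that(3,4)] by blast
qed

end

theorem theorem6p6: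
  shows "(NGSM :: ('a::finite list \<times> 'b::finite list) set set) \<inter> NMSO_ed = NGSM_fv"
proof (intro equalityI subsetI)
  fix m :: "('a list \<times> 'b list) set" assume "m \<in> NGSM \<inter> NMSO_ed"
  then obtain M :: "('a, 'b) gsm" where M: "gsm_wf M" "m = gsm_rel M" and "m \<in> NMSO_ed"
    by (auto simp: NGSM_def)
  then obtain B where "\<And>w z. (w, z) \<in> gsm_rel M \<Longrightarrow> length z \<le> B w"
    using NMSO_ed_bounded by blast
  then have "finite_visit M" by (rule bounded_finite_visit[OF M(1)])
  then show "m \<in> NGSM_fv" using M by (auto simp: NGSM_fv_def)
next
  fix m :: "('a list \<times> 'b list) set" assume "m \<in> NGSM_fv"
  then obtain M :: "('a, 'b) gsm" where M: "gsm_wf M" "m = gsm_rel M" "finite_visit M"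
    by (auto simp: NGSM_fv_def)
  then obtain k where k: "\<And>w z. (w, z) \<in> gsm_rel M \<Longrightarrow> \<exists>cs. gsm_succ M w z cs \<and> k_visiting k cs"
    unfolding finite_visit_def by blast
  interpret wf_gsm M by unfold_locales (rule M(1))
  have "length z \<le> k * (length w + 2) * max_out M" if "(w, z) \<in> gsm_rel M" for w z
    using k[OF that] k_visiting_bound[OF M(1)] by blast
  then have "gsm_rel M \<in> NMSO_ed" by (rule bounded_NMSO_ed)
  then show "m \<in> NGSM \<inter> NMSO_ed" using M by (auto simp: NGSM_def)
qed

end
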